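(* Let $\mathcal H$ be an infinite-dimensional separable complex Hilbert space and let $S$ be a closed non-densely defined symmetric operator in $\mathcal H$ with infinite-dimensional deficiency subspaces (i.e. both deficiency indices of $S$ are infinite). Then there exist maximal dissipative extensions $T$ of $S$ in $\mathcal H$ such that $T\in\mathbf D_{\rm sing}$ and $S$ is the Hermitian part of $T$.
   Context: A linear operator $S$ (not necessarily densely defined) is symmetric if $\mathrm{Im}(Sf,f)=0$ for all $f\in\mathrm{dom}\,S$. For a closed symmetric $S$ and $\lambda\in\mathbb C\setminus\mathbb R$, $\mathfrak M_\lambda=\mathrm{ran}(S-\lambda I)$, $\mathfrak N_\lambda=\mathfrak M_{\bar\lambda}^\perp$; the deficiency indices are $n_+=\dim\mathfrak N_\lambda$ ($\mathrm{Im}\,\lambda>0$) and $n_-=\dim\mathfrak N_\lambda$ ($\mathrm{Im}\,\lambda<0$). A linear operator $T$ in $\mathcal H$ is dissipative if $\mathrm{Im}(Tf,f)\ge 0$ for all $f\in\mathrm{dom}\,T$, and maximal dissipative if it is dissipative and has no proper dissipative (operator) extension in $\mathcal H$. $T\in\mathbf D_{\rm sing}$ means that $T$ is maximal dissipative and the form $\gamma_T[f]=\mathrm{Im}(Tf,f)$, $f\in\mathrm{dom}\,T$, is singular: for every $f\in\mathrm{dom}\,T$ there is a sequence $\{f_n\}\subset\mathrm{dom}\,T$ with $f_n\to f$ in $\mathcal H$ and $\mathrm{Im}(Tf_n,f_n)\to0$. The Hermitian domain of a maximal dissipative $T$ is $\mathfrak S_T=\{f\in\mathrm{dom}\,T:\mathrm{Im}(Tf,f)=0\}$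 (a linear manifold), and the Hermitian part of $T$ is the restriction of $T$ to $\mathfrak S_T$. *)

theory Defs
  imports "HOL-Analysis.Analysis" "HOL-Library.Extended_Nat"
begin

section \<open>Complex Hilbert spaces\<close>

text \<open>
  A complex inner product space is a real one (\<^class>\<open>real_inner\<close>, which supplies the norm and the
  topology) together with a complex scalar multiplication extending the real one and a complex
  inner product, linear in its \<^emph>\<open>first\<close> argument, whose real part is the given real inner product.
  In particular the norm is the one induced by the complex inner product. Linearity in the first
  argument matters: it fixes the sign of \<open>Im (T f, f)\<close>, hence the meaning of dissipativity.
\<close>

class complex_inner = real_inner +
  fixes scaleC :: "complex \<Rightarrow> 'a \<Rightarrow> 'a"  (infixr \<open>*\<^sub>C\<close> 75)
    and cinner :: "'a \<Rightarrow> 'a \<Rightarrow> complex"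
  assumes scaleC_add_right: "a *\<^sub>C (x + y) = a *\<^sub>C x + a *\<^sub>C y"
    and scaleC_add_left: "(a + b) *\<^sub>C x = a *\<^sub>C x + b *\<^sub>C x"
    and scaleC_scaleC: "a *\<^sub>C (b *\<^sub>C x) = (a * b) *\<^sub>C x"
    and scaleC_one: "1 *\<^sub>C x = x"
    and scaleC_of_real: "complex_of_real r *\<^sub>C x = r *\<^sub>R x"
    and cinner_commute: "cinner x y = cnj (cinner y x)"
    and cinner_add_left: "cinner (x + y) z = cinner x z + cinner y z"
    and cinner_scaleC_left: "cinner (a *\<^sub>C x) y = a * cinner x y"
    and Re_cinner: "Re (cinner x y) = inner x y"

class complex_hilbert_space = complex_inner + complete_space

global_interpretation complex_vector:
  vector_space "scaleC :: complex \<Rightarrow> 'a \<Rightarrow> 'a::complex_inner"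
  by unfold_locales
    (simp_all add: scaleC_add_right scaleC_add_left scaleC_scaleC scaleC_one)

text \<open>
  \<open>complex_vector.dim\<close> is the cardinality of a Hamel basis, but \<open>0\<close> if that is infinite. Below, all
  infinite dimensions are identified; in a separable space this loses nothing for the Hilbert
  dimension of a closed subspace.
\<close>

definition cdim :: "'a::complex_inner set \<Rightarrow> enat" where
  "cdim V = (if \<exists>B. finite B \<and> V \<subseteq> complex_vector.span B then enat (complex_vector.dim V) else \<infinity>)"

definition corthogonal_comp :: "'a::complex_inner set \<Rightarrow> 'a set" where
  "corthogonal_comp V = {x. \<forall>y\<in>V. cinner x y = 0}"


section \<open>Linear operators\<close>

text \<open>
  A linear operator, not necessarily densely defined, is identified with its graph. Thus its domain
  is \<^term>\<open>Domain T\<close>, an extension of \<open>T\<close> is an operator \<open>T'\<close> with \<open>T \<subseteq> T'\<close>, and \<open>T\<close> is a closed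
  operator iff \<^term>\<open>closed T\<close> holds in the product space.
\<close>

type_synonym 'a operator = "('a \<times> 'a) set"

definition linear_operator :: "'a::complex_inner operator \<Rightarrow> bool" where
  "linear_operator T \<longleftrightarrow>
     single_valued T \<and> (0, 0) \<in> T \<and>
     (\<forall>f g f' g'. (f, g) \<in> T \<longrightarrow> (f', g') \<in> T \<longrightarrow> (f + f', g + g') \<in> T) \<and>
     (\<forall>c f g. (f, g) \<in> T \<longrightarrow> (c *\<^sub>C f, c *\<^sub>C g) \<in> T)"

text \<open>The value \<open>T f\<close>; meaningful only for \<open>T\<close> single-valued and \<open>f \<in> Domain T\<close>.\<close>

definition op_app :: "'a operator \<Rightarrow> 'a \<Rightarrow> 'a" where
  "op_app T f = (THE g. (f, g) \<in> T)"

lemma op_app_eq: "single_valued T \<Longrightarrow> (f, g) \<in> T \<Longrightarrow> op_app T f = g"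
  unfolding op_app_def by (auto dest: single_valuedD)

definition im_form :: "'a::complex_inner operator \<Rightarrow> 'a \<Rightarrow> real" where
  "im_form T f = Im (cinner (op_app T f) f)"

definition symmetric_operator :: "'a::complex_inner operator \<Rightarrow> bool" where
  "symmetric_operator S \<longleftrightarrow> linear_operator S \<and> (\<forall>f\<in>Domain S. im_form S f = 0)"

definition densely_defined :: "'a::complex_inner operator \<Rightarrow> bool" where
  "densely_defined T \<longleftrightarrow> closure (Domain T) = UNIV"

definition ran_shift :: "'a::complex_inner operator \<Rightarrow> complex \<Rightarrow> 'a set" where
  "ran_shift S \<mu> = {op_app S f - \<mu> *\<^sub>C f | f. f \<in> Domain S}"

definition deficiency_subspace :: "'a::complex_inner operator \<Rightarrow> complex \<Rightarrow> 'a set" where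
  "deficiency_subspace S \<mu> = corthogonal_comp (ran_shift S (cnj \<mu>))"

text \<open>
  For closed symmetric \<open>S\<close> the dimension of the deficiency subspace is constant on each open
  half-plane, so the indices below exist and are unique.
\<close>

definition has_deficiency_indices :: "'a::complex_inner operator \<Rightarrow> enat \<Rightarrow> enat \<Rightarrow> bool" where
  "has_deficiency_indices S n_plus n_minus \<longleftrightarrow>
     (\<forall>\<mu>. Im \<mu> > 0 \<longrightarrow> cdim (deficiency_subspace S \<mu>) = n_plus) \<and>
     (\<forall>\<mu>. Im \<mu> < 0 \<longrightarrow> cdim (deficiency_subspace S \<mu>) = n_minus)"

definition dissipative :: "'a::complex_inner operator \<Rightarrow> bool" where
  "dissipative T \<longleftrightarrow> linear_operator T \<and> (\<forall>f\<in>Domain T. im_form T f \<ge> 0)"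

definition maximal_dissipative :: "'a::complex_inner operator \<Rightarrow> bool" where
  "maximal_dissipative T \<longleftrightarrow> dissipative T \<and> (\<forall>T'. dissipative T' \<longrightarrow> T \<subseteq> T' \<longrightarrow> T' = T)"

definition singular_im_form :: "'a::complex_inner operator \<Rightarrow> bool" where
  "singular_im_form T \<longleftrightarrow>
     (\<forall>f\<in>Domain T. \<exists>u :: nat \<Rightarrow> 'a. (\<forall>n. u n \<in> Domain T) \<and>
        u \<longlonglongrightarrow> f \<and> (\<lambda>n. im_form T (u n)) \<longlonglongrightarrow> 0)"

definition D_sing :: "'a::complex_inner operator set" where
  "D_sing = {T. maximal_dissipative T \<and> singular_im_form T}"

definition hermitian_domain :: "'a::complex_inner operator \<Rightarrow> 'a set" where
  "hermitian_domain T = {f \<in> Domain T. im_form T f = 0}"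

definition hermitian_part :: "'a::complex_inner operator \<Rightarrow> 'a operator" where
  "hermitian_part T = {(f, g) \<in> T. f \<in> hermitian_domain T}"

end

theory Submission
  imports Defs
begin

text \<open>
  The Cayley transform \<open>(T + i) f \<mapsto> (T - i) f\<close> turns the problem into one about contractions. It
  takes \<open>S\<close> to an isometry \<open>V\<close> from the closed subspace \<open>M = ran (S + i)\<close> onto \<open>ran (S - i)\<close> with no
  fixed vector except \<open>0\<close>; the orthogonal complements \<open>N\<close>, \<open>N'\<close> of these two ranges are the
  deficiency subspaces, so they are infinite-dimensional. Conversely, a contraction \<open>W\<close> on the whole
  space without nonzero fixed vector is the Cayley transform of a maximal dissipative \<open>T\<close>, and
  \<open>4 Im (T f, f) = \<parallel>x\<parallel>\<^sup>2 - \<parallel>W x\<parallel>\<^sup>2\<close> for \<open>x = (T + i) f\<close>. Since \<open>x - W x = 2 i f\<close>, it suffices to find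
  a linear contraction \<open>W\<close> such that

  \<^item> \<open>W\<close> extends \<open>V\<close>, whence \<open>S \<subseteq> T\<close>;
  \<^item> \<open>\<parallel>W x\<parallel> < \<parallel>x\<parallel>\<close> for \<open>x \<notin> M\<close>, whence \<open>S\<close> is the Hermitian part of \<open>T\<close>, and \<open>W\<close> inherits from \<open>V\<close>
    that it fixes no nonzero vector;
  \<^item> every \<open>y\<close> is a limit of vectors \<open>x - W x\<close> for which \<open>\<parallel>x\<parallel>\<^sup>2 - \<parallel>W x\<parallel>\<^sup>2\<close> tends to \<open>0\<close>, whence the form of
    \<open>T\<close> is singular.

  Such a \<open>W\<close> is a small perturbation of an isometry. Suppose that \<open>U\<close> is an isometry of the whole
  space extending \<open>V\<close>, that \<open>v 0, v 1, \<dots>\<close> are vectors with orthogonal complement \<open>M\<close>, and that for each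
  \<open>J\<close> the map \<open>x \<mapsto> x - U x\<close> takes the orthogonal complement of \<open>{v j | j < J}\<close> onto a dense set. Put
  \<open>W = U (1 - B)\<close> with \<open>B x = (\<Sum>j. t j (x, v j) v j)\<close> and positive \<open>t j\<close>. The defect
  \<open>\<parallel>x\<parallel>\<^sup>2 - \<parallel>W x\<parallel>\<^sup>2\<close> lies between \<open>(B x, x)\<close> and \<open>2 (B x, x)\<close>, so it vanishes exactly on \<open>M\<close>. Good
  approximants \<open>x\<close> of the members of a dense sequence by \<open>x - U x\<close> exist orthogonal to any number of
  initial \<open>v j\<close>, and they do not depend on \<open>t\<close>; hence \<open>t\<close> can be chosen to decay so fast that \<open>B\<close> is
  negligible on all of them. This is \<open>contraction_with_singular_defect\<close>.

  It remains to find \<open>U\<close> and \<open>v\<close> (\<open>isometric_extension_with_dense_differences\<close>). Let \<open>L\<close> be the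
  orthogonal complement of all \<open>x - V x\<close> with \<open>x \<in> M\<close>. A vector \<open>a\<close> that obstructs density for
  \<open>J\<close> belongs to \<open>L\<close>, and \<open>x \<mapsto> (x - U x, a)\<close> is a combination of the \<open>(x, v j)\<close> with \<open>j < J\<close>. There are
  orthonormal families \<open>h k\<close> in \<open>N\<close> and \<open>h' k\<close> in \<open>N'\<close> that \<open>L\<close> does not distinguish, in the sense that
  \<open>(a, h k) = (a, h' k)\<close> for \<open>a \<in> L\<close> (\<open>paired_orthonormal_sequences\<close>). Let \<open>U\<close> act on them as a shift,
  \<open>U (h k) = h' (k + 1)\<close>. Then \<open>(h k - U (h k), a)\<close> is the increment \<open>\<alpha> k - \<alpha> (k + 1)\<close> of
  the null sequence \<open>\<alpha> k = (h k, a)\<close>, so the series of these increments converges; whereas a vector \<open>v\<close>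
  with \<open>(h k, v) = 1 / (k + 1)\<close> for large \<open>k\<close> would make it a multiple of the harmonic series. Using
  infinitely many disjoint families \<open>h\<close>, one for each \<open>v j\<close>, excludes every nontrivial combination of the
  \<open>v j\<close>. The remaining case \<open>(x - U x, a) = 0\<close> for all \<open>x\<close> forces \<open>a = 0\<close>, since a constant null
  sequence vanishes.
\<close>

instance complex_hilbert_space \<subseteq> banach ..

section \<open>Complex inner product spaces\<close>

abbreviation csubspace :: "'a::complex_inner set \<Rightarrow> bool" where
  "csubspace \<equiv> complex_vector.subspace"

lemma cinner_add_right: "cinner x (y + z) = cinner x y + cinner x (z::'a::complex_inner)"
  by (metis cinner_add_left cinner_commute complex_cnj_add)

lemma cinner_scaleC_right: "cinner x (a *\<^sub>C y) = cnj a * cinner x (y::'a::complex_inner)"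
  by (metis cinner_commute cinner_scaleC_left complex_cnj_mult)

lemma cinner_scaleR_left: "cinner (r *\<^sub>R x) y = of_real r * cinner x (y::'a::complex_inner)"
  by (metis cinner_scaleC_left scaleC_of_real)

lemma cinner_scaleR_right: "cinner x (r *\<^sub>R y) = of_real r * cinner x (y::'a::complex_inner)"
  by (metis cinner_scaleC_right complex_cnj_complex_of_real scaleC_of_real)

lemma cinner_zero_left [simp]: "cinner 0 y = 0" for y :: "'a::complex_inner"
  using cinner_scaleR_left[of 0 0 y] by simp

lemma cinner_zero_right [simp]: "cinner y 0 = 0" for y :: "'a::complex_inner"
  using cinner_scaleR_right[of y 0 0] by simp

lemma cinner_minus_left: "cinner (- x) y = - cinner x (y::'a::complex_inner)"
  using cinner_scaleR_left[of "-1" x y] by simp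

lemma cinner_minus_right: "cinner x (- y) = - cinner x (y::'a::complex_inner)"
  using cinner_scaleR_right[of x "-1" y] by simp

lemma cinner_diff_left: "cinner (x - y) z = cinner x z - cinner y (z::'a::complex_inner)"
  using cinner_add_left[of x "-y" z] by (simp add: cinner_minus_left)

lemma cinner_diff_right: "cinner z (x - y) = cinner z x - cinner z (y::'a::complex_inner)"
  using cinner_add_right[of z x "-y"] by (simp add: cinner_minus_right)

lemmas cinner_linear_simps = cinner_add_left cinner_add_right cinner_diff_left cinner_diff_right
  cinner_scaleC_left cinner_scaleC_right cinner_minus_left cinner_minus_right

lemma cinner_eq_0_commute: "cinner x y = 0 \<longleftrightarrow> cinner y (x::'a::complex_inner) = 0"
  by (metis cinner_commute complex_cnj_zero)

lemma cinner_self: "cinner x x = complex_of_real ((norm x)\<^sup>2)" for x :: "'a::complex_inner"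
proof (rule complex_eqI)
  show "Re (cinner x x) = Re (complex_of_real ((norm x)\<^sup>2))"
    by (simp add: Re_cinner power2_norm_eq_inner)
  have "Im (cinner x x) = - Im (cinner x x)"
    by (subst cinner_commute) simp
  then show "Im (cinner x x) = Im (complex_of_real ((norm x)\<^sup>2))" by simp
qed

lemma cinner_self_eq_0_iff [simp]: "cinner x x = 0 \<longleftrightarrow> x = (0::'a::complex_inner)"
  by (simp add: cinner_self)

lemma norm_scaleC: "norm (a *\<^sub>C x) = cmod a * norm (x::'a::complex_inner)"
proof -
  have "complex_of_real ((norm (a *\<^sub>C x))\<^sup>2) = complex_of_real ((cmod a * norm x)\<^sup>2)"
    unfolding cinner_self[symmetric] cinner_scaleC_left cinner_scaleC_right
    by (simp add: cinner_self power_mult_distrib complex_norm_square mult.assoc[symmetric]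
        del: of_real_power)
  then have "(norm (a *\<^sub>C x))\<^sup>2 = (cmod a * norm x)\<^sup>2"
    using of_real_eq_iff by blast
  then show ?thesis by (simp add: power2_eq_iff_nonneg)
qed

lemma norm_add_square:
  "(norm (x + y))\<^sup>2 = (norm x)\<^sup>2 + (norm y)\<^sup>2 + 2 * Re (cinner x (y::'a::complex_inner))"
  by (simp add: power2_norm_eq_inner Re_cinner inner_add_left inner_add_right inner_commute)

lemma norm_diff_square:
  "(norm (x - y))\<^sup>2 = (norm x)\<^sup>2 + (norm y)\<^sup>2 - 2 * Re (cinner x (y::'a::complex_inner))"
  by (simp add: power2_norm_eq_inner Re_cinner inner_diff_left inner_diff_right inner_commute)

lemma norm_cinner_le: "cmod (cinner x y) \<le> norm x * norm (y::'a::complex_inner)"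
proof -
  let ?z = "cinner x y"
  have "complex_of_real (cmod ?z) = cnj (sgn ?z) * ?z"
    by (cases "?z = 0") (auto simp: sgn_eq complex_norm_square[symmetric] field_simps power2_eq_square
        simp flip: of_real_mult)
  also have "\<dots> = cinner (cnj (sgn ?z) *\<^sub>C x) y" by (simp add: cinner_scaleC_left)
  finally have "cmod ?z = inner (cnj (sgn ?z) *\<^sub>C x) y"
    by (metis Re_complex_of_real Re_cinner)
  also have "\<dots> \<le> norm (cnj (sgn ?z) *\<^sub>C x) * norm y" by (rule norm_cauchy_schwarz)
  also have "\<dots> \<le> norm x * norm y"
    by (intro mult_right_mono) (auto simp: norm_scaleC norm_sgn)
  finally show ?thesis .
qed

lemma bounded_linear_cinner_left: "bounded_linear (\<lambda>x. cinner x (y::'a::complex_inner))"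
  by (rule bounded_linear_intro[of _ "norm y"])
    (auto simp: cinner_add_left cinner_scaleR_left norm_cinner_le scaleR_conv_of_real)

lemma bounded_linear_cinner_right: "bounded_linear (\<lambda>y. cinner (x::'a::complex_inner) y)"
  by (rule bounded_linear_intro[of _ "norm x"])
    (auto simp: cinner_add_right cinner_scaleR_right norm_cinner_le mult.commute scaleR_conv_of_real
      intro: order_trans[OF norm_cinner_le])

lemmas cinner_sum_right = linear_sum[OF bounded_linear.linear[OF bounded_linear_cinner_right]]

lemma bounded_linear_scaleC_right: "bounded_linear (\<lambda>x::'a::complex_inner. c *\<^sub>C x)"
  by (rule bounded_linear_intro[of _ "cmod c"])
    (auto simp: scaleC_add_right norm_scaleC mult.commute scaleC_scaleC simp flip: scaleC_of_real)

lemma csubspace_sgn: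
  assumes "csubspace A" "x \<in> A"
  shows "sgn x \<in> A"
  using complex_vector.subspace_scale[OF assms, of "complex_of_real (inverse (norm x))"]
  by (simp only: scaleC_of_real sgn_div_norm)

lemma csubspace_image:
  fixes f :: "'a::complex_inner \<Rightarrow> 'b::complex_inner"
  assumes A: "csubspace A" and f: "\<And>x y. f (x + y) = f x + f y" "\<And>c x. f (c *\<^sub>C x) = c *\<^sub>C f x"
  shows "csubspace (f ` A)"
proof (rule complex_vector.subspaceI)
  have "f 0 = 0" using f(2)[of 0 0] by simp
  then show "0 \<in> f ` A" using complex_vector.subspace_0[OF A] by force
  show "x + y \<in> f ` A" if "x \<in> f ` A" "y \<in> f ` A" for x y
    using that complex_vector.subspace_add[OF A] by (auto simp: f(1)[symmetric])
  show "c *\<^sub>C x \<in> f ` A" if "x \<in> f ` A" for x c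
    using that complex_vector.subspace_scale[OF A] by (auto simp: f(2)[symmetric])
qed

lemma orthogonal_to_dense_sequence:
  fixes z :: "'a::complex_hilbert_space"
  assumes q: "closure (range q) = UNIV" and z: "\<And>n::nat. cinner z (q n) = 0"
  shows "z = 0"
proof -
  have "range q \<subseteq> {x. cinner z x = 0}" using z by auto
  moreover have "closed {x. cinner z x = 0}"
    by (intro closed_Collect_eq linear_continuous_on[OF bounded_linear_cinner_right] continuous_on_const)
  ultimately have "closure (range q) \<subseteq> {x. cinner z x = 0}" by (rule closure_minimal)
  then have "cinner z z = 0" using q by blast
  then show ?thesis by simp
qed

section \<open>Orthogonal projections\<close>

lemma mem_corthogonal_comp: "x \<in> corthogonal_comp V \<longleftrightarrow> (\<forall>y\<in>V. cinner x y = 0)"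
  by (simp add: corthogonal_comp_def)

lemma csubspace_corthogonal_comp [simp]: "csubspace (corthogonal_comp V)"
  by (rule complex_vector.subspaceI) (auto simp: mem_corthogonal_comp cinner_linear_simps)

lemma closed_corthogonal_comp [simp]: "closed (corthogonal_comp V)"
proof -
  have "corthogonal_comp V = (\<Inter>y\<in>V. (\<lambda>x. cinner x y) -` {0})"
    by (auto simp: mem_corthogonal_comp)
  moreover have "closed ((\<lambda>x. cinner x y) -` {0})" for y :: 'a
    by (intro closed_vimage closed_singleton
        linear_continuous_on[OF bounded_linear_cinner_left])
  ultimately show ?thesis by auto
qed

text \<open>A minimizing sequence for the distance from \<open>x\<close> to \<open>A\<close> is Cauchy by the parallelogram law;
  the first variation of the distance at its limit vanishes.\<close>

lemma orthogonal_projection_exists: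
  fixes A :: "'a::complex_hilbert_space set"
  assumes A: "csubspace A" "closed A"
  shows "\<exists>p\<in>A. \<forall>y\<in>A. cinner (x - p) y = 0"
proof -
  have ne: "A \<noteq> {}" using complex_vector.subspace_0[OF A(1)] by auto
  define d where "d = infdist x A"
  have d_le: "d \<le> norm (x - y)" if "y \<in> A" for y
    using infdist_le[OF that, of x] by (simp add: d_def dist_norm)
  have d0: "d \<ge> 0" by (simp add: d_def infdist_nonneg)
  have "\<exists>y\<in>A. norm (x - y) < d + inverse (Suc n)" for n
  proof (rule ccontr)
    assume "\<not> ?thesis"
    then have "d + inverse (Suc n) \<le> infdist x A"
      unfolding infdist_notempty[OF ne] by (intro cINF_greatest ne) (auto simp: dist_norm not_less)
    then show False by (simp add: d_def)
  qed
  then obtain p where pA: "\<And>n. p n \<in> A" and p: "\<And>n::nat. norm (x - p n) < d + inverse (Suc n)"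
    by metis
  have para: "(norm (p m - p n))\<^sup>2 \<le> 2 * (norm (x - p m))\<^sup>2 + 2 * (norm (x - p n))\<^sup>2 - 4 * d\<^sup>2" for m n
  proof -
    have "(1/2) *\<^sub>C (p m + p n) \<in> A"
      by (intro complex_vector.subspace_scale complex_vector.subspace_add A pA)
    then have "d \<le> norm (x - (1/2) *\<^sub>C (p m + p n))" by (rule d_le)
    also have "(1/2) *\<^sub>C (p m + p n) = (1/2) *\<^sub>R (p m + p n)"
      using scaleC_of_real[of "1/2"] by simp
    finally have "2 * d \<le> norm ((x - p m) + (x - p n))"
    proof -
      assume "d \<le> norm (x - (1/2) *\<^sub>R (p m + p n))"
      moreover have "(x - p m) + (x - p n) = 2 *\<^sub>R (x - (1/2) *\<^sub>R (p m + p n))"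
        by (simp add: algebra_simps scaleR_2)
      ultimately show ?thesis by simp
    qed
    then have "(2 * d)\<^sup>2 \<le> (norm ((x - p m) + (x - p n)))\<^sup>2"
      using d0 by (intro power_mono) auto
    moreover have "(norm ((x - p m) + (x - p n)))\<^sup>2 + (norm ((x - p n) - (x - p m)))\<^sup>2
        = 2 * (norm (x - p m))\<^sup>2 + 2 * (norm (x - p n))\<^sup>2"
      unfolding norm_add_square norm_diff_square by (subst cinner_commute) simp
    ultimately show ?thesis by (simp add: power_mult_distrib)
  qed
  have lim: "(\<lambda>n. norm (x - p n)) \<longlonglongrightarrow> d"
  proof (rule tendsto_sandwich)
    show "(\<lambda>n. d) \<longlonglongrightarrow> d" by simp
    show "(\<lambda>n. d + inverse (real (Suc n))) \<longlonglongrightarrow> d"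
      using tendsto_add[OF tendsto_const LIMSEQ_inverse_real_of_nat, of d] by simp
  qed (use d_le[OF pA] p in \<open>auto intro!: always_eventually less_imp_le\<close>)
  have "Cauchy p"
  proof (rule CauchyI)
    fix e :: real assume e: "e > 0"
    have "(\<lambda>n. 2 * (norm (x - p n))\<^sup>2 - 2 * d\<^sup>2) \<longlonglongrightarrow> 2 * d\<^sup>2 - 2 * d\<^sup>2"
      by (intro tendsto_intros lim)
    then have "\<forall>\<^sub>F n in sequentially. 2 * (norm (x - p n))\<^sup>2 - 2 * d\<^sup>2 < e\<^sup>2 / 2"
      using e by (intro order_tendstoD) auto
    then obtain K where K: "\<And>n. n \<ge> K \<Longrightarrow> 2 * (norm (x - p n))\<^sup>2 - 2 * d\<^sup>2 < e\<^sup>2 / 2"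
      by (auto simp: eventually_sequentially)
    have "norm (p m - p n) < e" if "m \<ge> K" "n \<ge> K" for m n
    proof -
      have "(norm (p m - p n))\<^sup>2 < e\<^sup>2" using para[of m n] K[OF that(1)] K[OF that(2)] by simp
      then show ?thesis using e by (auto intro: power2_less_imp_less)
    qed
    then show "\<exists>M. \<forall>m\<ge>M. \<forall>n\<ge>M. norm (p m - p n) < e" by blast
  qed
  then obtain q where q: "p \<longlonglongrightarrow> q" using Cauchy_convergent convergent_def by blast
  have qA: "q \<in> A" using A(2) pA q by (metis closed_sequentially)
  have "(\<lambda>n. norm (x - p n)) \<longlonglongrightarrow> norm (x - q)" by (intro tendsto_intros q)
  then have qd: "norm (x - q) = d" using lim LIMSEQ_unique by blast
  have "cinner (x - q) y = 0" if y: "y \<in> A" for y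
  proof (cases "y = 0")
    case False
    define c where "c = cinner (x - q) y / cinner y y"
    have "q + c *\<^sub>C y \<in> A"
      by (intro complex_vector.subspace_add complex_vector.subspace_scale A qA y)
    then have "d\<^sup>2 \<le> (norm ((x - q) - c *\<^sub>C y))\<^sup>2"
      using d_le d0 by (intro power_mono) (auto simp: algebra_simps)
    also have "\<dots> = d\<^sup>2 + (norm (c *\<^sub>C y))\<^sup>2 - 2 * Re (cinner (x - q) (c *\<^sub>C y))"
      by (simp add: norm_diff_square qd)
    also have "cinner (x - q) (c *\<^sub>C y) = cinner (c *\<^sub>C y) (c *\<^sub>C y)"
      using False by (simp add: cinner_scaleC_right cinner_scaleC_left c_def)
    finally have "norm (c *\<^sub>C y) = 0" by (simp add: cinner_self del: of_real_power)
    then show ?thesis using False by (simp add: norm_scaleC c_def)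
  qed simp
  then show ?thesis using qA by blast
qed

definition cproj :: "'a::complex_hilbert_space set \<Rightarrow> 'a \<Rightarrow> 'a" where
  "cproj A x = (SOME p. p \<in> A \<and> (\<forall>y\<in>A. cinner (x - p) y = 0))"

lemma
  assumes "csubspace A" "closed A"
  shows cproj_in: "cproj A x \<in> A"
    and cproj_orthogonal: "y \<in> A \<Longrightarrow> cinner (x - cproj A x) y = 0"
  using someI_ex[of "\<lambda>p. p \<in> A \<and> (\<forall>y\<in>A. cinner (x - p) y = 0)"]
    orthogonal_projection_exists[OF assms, of x]
  by (auto simp: cproj_def)

lemma cproj_unique:
  assumes A: "csubspace A" "closed A" and "p \<in> A" "\<And>y. y \<in> A \<Longrightarrow> cinner (x - p) y = 0"
  shows "cproj A x = p"
proof -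
  have d: "cproj A x - p \<in> A" using A assms(3) by (simp add: complex_vector.subspace_diff cproj_in)
  have "cinner (cproj A x - p) (cproj A x - p)
      = cinner (x - p) (cproj A x - p) - cinner (x - cproj A x) (cproj A x - p)"
    by (simp add: cinner_linear_simps)
  also have "\<dots> = 0" using assms(4)[OF d] cproj_orthogonal[OF A d] by simp
  finally show ?thesis by simp
qed

lemma cproj_add:
  assumes A: "csubspace A" "closed A"
  shows "cproj A (x + y) = cproj A x + cproj A y"
proof (rule cproj_unique[OF A])
  show "cproj A x + cproj A y \<in> A"
    by (intro complex_vector.subspace_add[OF A(1)] cproj_in A)
  show "cinner (x + y - (cproj A x + cproj A y)) z = 0" if "z \<in> A" for z
    using cproj_orthogonal[OF A that, of x] cproj_orthogonal[OF A that, of y]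
    by (simp add: cinner_linear_simps)
qed

lemma cproj_scaleC:
  assumes A: "csubspace A" "closed A"
  shows "cproj A (c *\<^sub>C x) = c *\<^sub>C cproj A x"
proof (rule cproj_unique[OF A])
  show "c *\<^sub>C cproj A x \<in> A"
    by (intro complex_vector.subspace_scale[OF A(1)] cproj_in A)
  show "cinner (c *\<^sub>C x - c *\<^sub>C cproj A x) z = 0" if "z \<in> A" for z
    using cproj_orthogonal[OF A that, of x] by (simp add: cinner_linear_simps)
qed

lemma cproj_self:
  assumes A: "csubspace A" "closed A" and "x \<in> A"
  shows "cproj A x = x"
  by (rule cproj_unique) (use assms in auto)

lemma norm_cproj_decompose:
  assumes A: "csubspace A" "closed A"
  shows "(norm x)\<^sup>2 = (norm (cproj A x))\<^sup>2 + (norm (x - cproj A x))\<^sup>2"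
  using norm_add_square[of "x - cproj A x" "cproj A x"]
  by (simp add: cproj_orthogonal[OF A] cproj_in[OF A])

text \<open>Density is tested against vectors in the second argument of the inner product, so that the test
  vector defines a functional that is linear rather than antilinear.\<close>

lemma dense_if_corthogonal_comp_trivial:
  fixes A :: "'a::complex_hilbert_space set"
  assumes A: "csubspace A" and triv: "\<And>a. (\<And>y. y \<in> A \<Longrightarrow> cinner y a = 0) \<Longrightarrow> a = 0"
  shows "closure A = UNIV"
proof -
  have clA: "csubspace (closure A)"
  proof (rule complex_vector.subspaceI)
    show "0 \<in> closure A" using complex_vector.subspace_0[OF A] closure_subset by blast
    show "x + y \<in> closure A" if xy: "x \<in> closure A" "y \<in> closure A" for x y
    proof -
      obtain u w where "\<And>n. u n \<in> A" "u \<longlonglongrightarrow> x" "\<And>n. w n \<in> A" "w \<longlonglongrightarrow> y"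
        using xy unfolding closure_sequential by blast
      then show ?thesis unfolding closure_sequential
        by (intro exI[of _ "\<lambda>n. u n + w n"])
          (auto intro!: tendsto_add complex_vector.subspace_add[OF A])
    qed
    show "c *\<^sub>C x \<in> closure A" if xy: "x \<in> closure A" for x c
    proof -
      obtain u where "\<And>n. u n \<in> A" "u \<longlonglongrightarrow> x"
        using xy unfolding closure_sequential by blast
      then show ?thesis unfolding closure_sequential
        by (intro exI[of _ "\<lambda>n. c *\<^sub>C u n"])
          (auto intro!: bounded_linear.tendsto[OF bounded_linear_scaleC_right]
            complex_vector.subspace_scale[OF A])
    qed
  qed
  have "x \<in> closure A" for x
  proof -
    let ?p = "cproj (closure A) x"
    have "x - ?p = 0"
    proof (rule triv)
      fix y assume "y \<in> A"
      then have "y \<in> closure A" using closure_subset by blast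
      then show "cinner y (x - ?p) = 0"
        using cproj_orthogonal[OF clA closed_closure] cinner_eq_0_commute by blast
    qed
    then show ?thesis using cproj_in[OF clA closed_closure, of x] by simp
  qed
  then show ?thesis by blast
qed

section \<open>Orthogonal series\<close>

text \<open>Zero members are permitted so that finite orthonormal systems, and redundant steps of the
  Gram-Schmidt process, need no separate index sets.\<close>

definition orthonormal_or_zero :: "(nat \<Rightarrow> 'a::complex_inner) \<Rightarrow> bool" where
  "orthonormal_or_zero e \<longleftrightarrow>
     (\<forall>m n. m \<noteq> n \<longrightarrow> cinner (e m) (e n) = 0) \<and> (\<forall>n. norm (e n) = 0 \<or> norm (e n) = 1)"

lemma orthonormal_or_zero_norm_le: "orthonormal_or_zero e \<Longrightarrow> norm (e n) \<le> 1"
  by (metis orthonormal_or_zero_def order_refl zero_le_one)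

lemma norm_orthogonal_sum:
  assumes e: "orthonormal_or_zero e" and "finite A"
  shows "(norm (\<Sum>n\<in>A. c n *\<^sub>C e n))\<^sup>2 = (\<Sum>n\<in>A. (cmod (c n))\<^sup>2 * (norm (e n))\<^sup>2)"
  using \<open>finite A\<close>
proof (induction A rule: finite_induct)
  case (insert m A)
  have "cinner (e m) (e n) = 0" if "n \<in> A" for n
    using that insert.hyps(2) e unfolding orthonormal_or_zero_def by metis
  then have zero: "cinner (c m *\<^sub>C e m) (c n *\<^sub>C e n) = 0" if "n \<in> A" for n
    using that by (simp add: cinner_scaleC_left cinner_scaleC_right)
  have "cinner (c m *\<^sub>C e m) (\<Sum>n\<in>A. c n *\<^sub>C e n) = (\<Sum>n\<in>A. cinner (c m *\<^sub>C e m) (c n *\<^sub>C e n))"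
    by (rule cinner_sum_right)
  also have "\<dots> = 0"
    by (intro sum.neutral ballI zero)
  finally show ?case
    using insert by (simp add: norm_add_square norm_scaleC power_mult_distrib)
qed simp

lemma summable_orthogonal_series:
  fixes e :: "nat \<Rightarrow> 'a::complex_hilbert_space"
  assumes e: "orthonormal_or_zero e" and c: "summable (\<lambda>n. (cmod (c n))\<^sup>2)"
  shows "summable (\<lambda>n. c n *\<^sub>C e n)"
  unfolding summable_Cauchy
proof (intro allI impI)
  fix d :: real assume d: "d > 0"
  then have "d\<^sup>2 > 0" by simp
  then obtain N where N: "\<And>m n. m \<ge> N \<Longrightarrow> norm (\<Sum>k\<in>{m..<n}. (cmod (c k))\<^sup>2) < d\<^sup>2"
    using c unfolding summable_Cauchy by blast
  have "norm (\<Sum>k\<in>{m..<n}. c k *\<^sub>C e k) < d" if "m \<ge> N" for m n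
  proof -
    have "(norm (\<Sum>k\<in>{m..<n}. c k *\<^sub>C e k))\<^sup>2 = (\<Sum>k\<in>{m..<n}. (cmod (c k))\<^sup>2 * (norm (e k))\<^sup>2)"
      by (rule norm_orthogonal_sum[OF e]) simp
    also have "\<dots> \<le> (\<Sum>k\<in>{m..<n}. (cmod (c k))\<^sup>2)"
      using orthonormal_or_zero_norm_le[OF e] by (intro sum_mono mult_left_le) (auto simp: power_le_one)
    also have "\<dots> < d\<^sup>2" using N[OF that, of n] by simp
    finally show ?thesis using d by (auto intro: power2_less_imp_less)
  qed
  then show "\<exists>N. \<forall>m\<ge>N. \<forall>n. norm (\<Sum>k\<in>{m..<n}. c k *\<^sub>C e k) < d" by blast
qed

lemma norm_orthogonal_series:
  fixes e :: "nat \<Rightarrow> 'a::complex_hilbert_space"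
  assumes e: "orthonormal_or_zero e" and c: "summable (\<lambda>n. (cmod (c n))\<^sup>2)"
  shows "(\<lambda>n. (cmod (c n))\<^sup>2 * (norm (e n))\<^sup>2) sums (norm (\<Sum>n. c n *\<^sub>C e n))\<^sup>2"
proof -
  have "(\<lambda>N. \<Sum>n<N. c n *\<^sub>C e n) \<longlonglongrightarrow> (\<Sum>n. c n *\<^sub>C e n)"
    by (rule summable_LIMSEQ[OF summable_orthogonal_series[OF e c]])
  then have "(\<lambda>N. (norm (\<Sum>n<N. c n *\<^sub>C e n))\<^sup>2) \<longlonglongrightarrow> (norm (\<Sum>n. c n *\<^sub>C e n))\<^sup>2"
    by (intro tendsto_intros)
  then show ?thesis by (simp add: norm_orthogonal_sum[OF e] sums_def)
qed

lemma cinner_orthogonal_series: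
  fixes e :: "nat \<Rightarrow> 'a::complex_hilbert_space"
  assumes e: "orthonormal_or_zero e" and c: "summable (\<lambda>n. (cmod (c n))\<^sup>2)"
  shows "(\<lambda>n. c n * cinner (e n) z) sums cinner (\<Sum>n. c n *\<^sub>C e n) z"
  using bounded_linear.sums[OF bounded_linear_cinner_left
      summable_sums[OF summable_orthogonal_series[OF e c]]]
  by (simp add: cinner_scaleC_left)

lemma cinner_orthogonal_series_coefficient:
  fixes e :: "nat \<Rightarrow> 'a::complex_hilbert_space"
  assumes e: "orthonormal_or_zero e" and c: "summable (\<lambda>n. (cmod (c n))\<^sup>2)"
  shows "cinner (\<Sum>n. c n *\<^sub>C e n) (e m) = c m * of_real ((norm (e m))\<^sup>2)"
proof -
  have "(\<lambda>n. c n * cinner (e n) (e m)) = (\<lambda>n. if n = m then c m * of_real ((norm (e m))\<^sup>2) else 0)"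
    using e by (auto simp: orthonormal_or_zero_def cinner_self)
  then have "(\<lambda>n. c n * cinner (e n) (e m)) sums (c m * of_real ((norm (e m))\<^sup>2))"
    using sums_single[of m "\<lambda>_. c m * of_real ((norm (e m))\<^sup>2)"] by simp
  then show ?thesis using cinner_orthogonal_series[OF e c] sums_unique2 by blast
qed

lemma cinner_norm_0_or_1:
  assumes "orthonormal_or_zero e"
  shows "cinner x (e n) * of_real ((norm (e n))\<^sup>2) = cinner x (e n)"
  using assms unfolding orthonormal_or_zero_def by (metis cinner_zero_right mult.right_neutral
      mult_zero_left norm_eq_zero of_real_1 one_power2)

lemma bessel_inequality:
  fixes e :: "nat \<Rightarrow> 'a::complex_inner"
  assumes e: "orthonormal_or_zero e"
  shows "(\<Sum>n<N. (cmod (cinner x (e n)))\<^sup>2) \<le> (norm x)\<^sup>2"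
proof -
  let ?s = "\<Sum>n<N. cinner x (e n) *\<^sub>C e n"
  have "cinner x ?s = (\<Sum>n<N. cinner x (cinner x (e n) *\<^sub>C e n))"
    by (rule cinner_sum_right)
  also have "\<dots> = of_real (\<Sum>n<N. (cmod (cinner x (e n)))\<^sup>2)"
    by (simp add: cinner_scaleC_right complex_norm_square mult.commute del: of_real_power)
  finally have 1: "Re (cinner x ?s) = (\<Sum>n<N. (cmod (cinner x (e n)))\<^sup>2)"
    by simp
  have "(norm ?s)\<^sup>2 \<le> (\<Sum>n<N. (cmod (cinner x (e n)))\<^sup>2)"
    unfolding norm_orthogonal_sum[OF e finite_lessThan]
    using orthonormal_or_zero_norm_le[OF e] by (intro sum_mono mult_left_le) (auto simp: power_le_one)
  moreover have "0 \<le> (norm (x - ?s))\<^sup>2" by simp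
  ultimately show ?thesis unfolding norm_diff_square 1 by linarith
qed

lemma summable_bessel:
  assumes "orthonormal_or_zero e"
  shows "summable (\<lambda>n. (cmod (cinner x (e n)))\<^sup>2)"
  by (rule summableI_nonneg_bounded[OF _ bessel_inequality[OF assms]]) simp

lemma orthonormal_sequence_weakly_null:
  assumes "orthonormal_or_zero e"
  shows "(\<lambda>n. cinner (e n) a) \<longlonglongrightarrow> 0"
proof -
  have "(\<lambda>n. (cmod (cinner a (e n)))\<^sup>2) \<longlonglongrightarrow> 0"
    by (rule summable_LIMSEQ_zero[OF summable_bessel[OF assms]])
  then have "(\<lambda>n. sqrt ((cmod (cinner a (e n)))\<^sup>2)) \<longlonglongrightarrow> sqrt 0"
    by (rule tendsto_real_sqrt)
  then have "(\<lambda>n. cmod (cinner (e n) a)) \<longlonglongrightarrow> 0"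
    by (subst cinner_commute) simp
  then show ?thesis by (rule tendsto_norm_zero_cancel)
qed

text \<open>Applied to a dense sequence \<open>x\<close>, this yields an orthonormal basis of the orthogonal complement of
  \<open>B\<close>. The vector \<open>g n\<close> is the normalized projection of \<open>x n\<close> to the complement of \<open>B\<close> and of the earlier
  \<open>x i\<close>; projecting along the \<open>x i\<close> instead of the \<open>g i\<close> makes the definition explicit rather than
  recursive.\<close>

lemma gram_schmidt_in_orthogonal_complement:
  fixes B :: "'a::complex_hilbert_space set" and x :: "nat \<Rightarrow> 'a"
  shows "\<exists>g. orthonormal_or_zero g \<and> (\<forall>n. g n \<in> corthogonal_comp B) \<and>
    (\<forall>z\<in>corthogonal_comp B. (\<forall>n. cinner z (g n) = 0) \<longrightarrow> (\<forall>n. cinner z (x n) = 0))"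
proof -
  define A where "A n = corthogonal_comp (B \<union> x ` {..<n})" for n
  define p where "p n = cproj (A n) (x n)" for n
  define g where "g n = sgn (p n)" for n
  have A: "csubspace (A n)" "closed (A n)" for n by (simp_all add: A_def)
  have pA: "p n \<in> A n" for n by (simp add: p_def cproj_in A)
  have gA: "g n \<in> A n" for n
    unfolding g_def by (rule csubspace_sgn[OF A(1) pA])
  have p_iff: "cinner z (p n) = cinner z (x n)" if "z \<in> A n" for z n
    using cproj_orthogonal[OF A that, of "x n"] cinner_eq_0_commute[of z "x n - p n"]
    by (simp add: p_def cinner_diff_right)
  have g_iff: "cinner z (g n) = 0 \<longleftrightarrow> cinner z (x n) = 0" if "z \<in> A n" for z n
    using p_iff[OF that] that
    by (cases "p n = 0") (auto simp: g_def sgn_div_norm cinner_scaleR_right)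
  have orth: "cinner (g n) (g m) = 0" if "m < n" for m n
  proof -
    have "g n \<in> A m" "cinner (g n) (x m) = 0"
      using gA[of n] that by (auto simp: A_def mem_corthogonal_comp)
    then show ?thesis by (simp add: g_iff)
  qed
  have "orthonormal_or_zero g"
    unfolding orthonormal_or_zero_def
  proof (intro conjI allI impI)
    show "cinner (g m) (g n) = 0" if "m \<noteq> n" for m n
      using orth[of m n] orth[of n m] that cinner_eq_0_commute by (meson nat_neq_iff)
    show "norm (g n) = 0 \<or> norm (g n) = 1" for n by (simp add: g_def norm_sgn)
  qed
  moreover have "g n \<in> corthogonal_comp B" for n
    using gA[of n] by (auto simp: A_def mem_corthogonal_comp)
  moreover have "cinner z (x n) = 0"
    if z: "z \<in> corthogonal_comp B" "\<forall>n. cinner z (g n) = 0" for z n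
  proof (induction n rule: less_induct)
    case (less n)
    then have "z \<in> A n" using z(1) by (auto simp: A_def mem_corthogonal_comp)
    then show ?case using g_iff z(2) by blast
  qed
  ultimately show ?thesis by blast
qed

section \<open>Finitely many orthogonality conditions\<close>

text \<open>No independence of the vectors \<open>v j\<close> is assumed, so one vector is split off at a time: either some
  \<open>u\<close> orthogonal to the earlier ones detects \<open>v J\<close>, and the coefficient of \<open>v J\<close> is read off at \<open>u\<close>, or the
  condition given by \<open>v J\<close> follows from the earlier ones.\<close>

lemma functional_vanishing_on_orthogonal_complement:
  fixes v :: "nat \<Rightarrow> 'a::complex_inner" and \<phi> :: "'a \<Rightarrow> complex"
  assumes "\<And>x y. \<phi> (x + y) = \<phi> x + \<phi> y" and "\<And>c x. \<phi> (c *\<^sub>C x) = c * \<phi> x"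
    and "\<And>x. (\<And>j. j < J \<Longrightarrow> cinner x (v j) = 0) \<Longrightarrow> \<phi> x = 0"
  shows "\<exists>c. \<forall>x. \<phi> x = (\<Sum>j<J. c j * cinner x (v j))"
  using assms
proof (induction J arbitrary: \<phi>)
  case (Suc J)
  show ?case
  proof (cases "\<exists>u. (\<forall>j<J. cinner u (v j) = 0) \<and> cinner u (v J) \<noteq> 0")
    case True
    then obtain u where u: "\<And>j. j < J \<Longrightarrow> cinner u (v j) = 0" "cinner u (v J) \<noteq> 0" by blast
    define d where "d = \<phi> u / cinner u (v J)"
    define \<psi> where "\<psi> x = \<phi> x - d * cinner x (v J)" for x
    have "\<exists>c. \<forall>x. \<psi> x = (\<Sum>j<J. c j * cinner x (v j))"
    proof (rule Suc.IH)
      show "\<psi> x = 0" if x: "\<And>j. j < J \<Longrightarrow> cinner x (v j) = 0" for x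
      proof -
        define w where "w = x + (- (cinner x (v J) / cinner u (v J))) *\<^sub>C u"
        have "\<phi> w = 0"
          by (rule Suc.prems(3)) (use u x in \<open>auto simp: w_def cinner_linear_simps less_Suc_eq\<close>)
        then show ?thesis
          unfolding w_def Suc.prems(1,2) by (simp add: \<psi>_def d_def)
      qed
    qed (auto simp: \<psi>_def Suc.prems cinner_linear_simps algebra_simps)
    then obtain c where "\<And>x. \<psi> x = (\<Sum>j<J. c j * cinner x (v j))" by blast
    then have "\<forall>x. \<phi> x = (\<Sum>j<Suc J. (c(J := d)) j * cinner x (v j))"
      by (simp add: \<psi>_def algebra_simps)
    then show ?thesis by blast
  next
    case False
    then have "\<exists>c. \<forall>x. \<phi> x = (\<Sum>j<J. c j * cinner x (v j))"
      by (intro Suc.IH Suc.prems) (auto simp: less_Suc_eq)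
    then obtain c where "\<And>x. \<phi> x = (\<Sum>j<J. c j * cinner x (v j))" by blast
    then have "\<forall>x. \<phi> x = (\<Sum>j<Suc J. (c(J := 0)) j * cinner x (v j))" by simp
    then show ?thesis by blast
  qed
qed simp

lemma cdim_infinite_iff: "cdim V = \<infinity> \<longleftrightarrow> (\<forall>B. finite B \<longrightarrow> \<not> V \<subseteq> complex_vector.span B)"
  by (auto simp: cdim_def)

text \<open>One further orthogonality condition lowers the dimension by at most one.\<close>

lemma infinite_dimension_inter_corthogonal_comp:
  assumes V: "csubspace V" "cdim V = \<infinity>" and "finite F"
  shows "cdim (V \<inter> corthogonal_comp F) = \<infinity>"
  using \<open>finite F\<close>
proof (induction F rule: finite_induct)
  case empty
  then show ?case using V by (simp add: corthogonal_comp_def)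
next
  case (insert b F)
  let ?W = "V \<inter> corthogonal_comp F" and ?W' = "V \<inter> corthogonal_comp (insert b F)"
  have W: "csubspace ?W" by (simp add: V complex_vector.subspace_inter)
  show ?case
    unfolding cdim_infinite_iff
  proof (intro allI impI notI)
    fix B assume B: "finite B" "?W' \<subseteq> complex_vector.span B"
    have "\<exists>u. ?W \<subseteq> complex_vector.span (insert u B)"
    proof (cases "\<exists>u\<in>?W. cinner u b \<noteq> 0")
      case True
      then obtain u where u: "u \<in> ?W" "cinner u b \<noteq> 0" by blast
      have "x \<in> complex_vector.span (insert u B)" if x: "x \<in> ?W" for x
      proof -
        define k where "k = cinner x b / cinner u b"
        have "x - k *\<^sub>C u \<in> ?W"
          by (intro complex_vector.subspace_diff complex_vector.subspace_scale W x u)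
        moreover have "cinner (x - k *\<^sub>C u) b = 0"
          using u by (simp add: cinner_linear_simps k_def)
        ultimately have "x - k *\<^sub>C u \<in> ?W'" by (auto simp: mem_corthogonal_comp)
        then show ?thesis using B complex_vector.span_breakdown_eq by blast
      qed
      then show ?thesis by blast
    next
      case False
      then have "?W = ?W'" by (auto simp: mem_corthogonal_comp)
      then show ?thesis using B complex_vector.span_mono[of B "insert 0 B"] by blast
    qed
    then show False using insert.IH B unfolding cdim_infinite_iff by (meson finite_insert)
  qed
qed

lemma unit_vector_orthogonal_to_finite_set:
  assumes V: "csubspace V" "cdim V = \<infinity>" and F: "finite F"
  shows "\<exists>x\<in>V. norm x = 1 \<and> (\<forall>b\<in>F. cinner x b = 0)"
proof -
  let ?W = "V \<inter> corthogonal_comp F"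
  have W: "csubspace ?W" by (simp add: V complex_vector.subspace_inter)
  have "\<not> ?W \<subseteq> complex_vector.span {}"
    using infinite_dimension_inter_corthogonal_comp[OF V F] unfolding cdim_infinite_iff
    by blast
  then obtain x where x: "x \<in> ?W" "x \<noteq> 0" by auto
  have "sgn x \<in> ?W" by (rule csubspace_sgn[OF W x(1)])
  then show ?thesis using x(2) by (intro bexI[of _ "sgn x"]) (auto simp: mem_corthogonal_comp norm_sgn)
qed

section \<open>Fixed-point-free partial isometries with infinite defects\<close>

text \<open>The increments of a convergent sequence are summable, and the harmonic series is not.\<close>

lemma harmonic_increments_not_convergent:
  fixes \<alpha> :: "nat \<Rightarrow> complex"
  assumes lim: "\<alpha> \<longlonglongrightarrow> l" and diff: "\<And>k. k \<ge> K \<Longrightarrow> \<alpha> k - \<alpha> (Suc k) = d / of_nat (Suc k)"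
  shows "d = 0"
proof (rule ccontr)
  assume d: "d \<noteq> 0"
  have "summable (\<lambda>k. \<alpha> k - \<alpha> (Suc k))" by (rule telescope_summable'[OF lim])
  then have "summable (\<lambda>k. \<alpha> (k + K) - \<alpha> (Suc (k + K)))"
    using summable_iff_shift[of "\<lambda>k. \<alpha> k - \<alpha> (Suc k)" K] by simp
  then have "summable (\<lambda>k. d / of_nat (Suc (k + K)))" by (simp add: diff del: of_nat_Suc)
  then have "summable (\<lambda>k. d / of_nat (Suc k))"
    using summable_iff_shift[of "\<lambda>k. d / of_nat (Suc k)" K] by simp
  then have "summable (\<lambda>k. inverse d * (d / of_nat (Suc k)))" by (rule summable_mult)
  then have "summable (\<lambda>k. complex_of_real (inverse (of_nat (Suc k))))"
    using d by (simp add: field_simps del: of_nat_Suc)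
  then have "summable (\<lambda>k. inverse (real (Suc k)))" by (simp only: summable_complex_of_real)
  then have "summable (\<lambda>k. inverse (real k))" using summable_Suc_iff by blast
  then show False using not_summable_harmonic[where 'a = real] by (simp add: field_simps)
qed

text \<open>The situation of the Cayley transform of a closed symmetric operator with infinite deficiency
  indices. Only the values of \<open>V\<close> on \<open>M\<close> matter.\<close>

locale fixpoint_free_partial_isometry =
  fixes M :: "'a::complex_hilbert_space set" and V :: "'a \<Rightarrow> 'a"
  assumes csubspace_M: "csubspace M" and closed_M: "closed M"
    and V_add: "\<And>x y. x \<in> M \<Longrightarrow> y \<in> M \<Longrightarrow> V (x + y) = V x + V y"
    and V_scaleC: "\<And>c x. x \<in> M \<Longrightarrow> V (c *\<^sub>C x) = c *\<^sub>C V x"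
    and norm_V: "\<And>x. x \<in> M \<Longrightarrow> norm (V x) = norm x"
    and V_fixpoint: "\<And>x. x \<in> M \<Longrightarrow> V x = x \<Longrightarrow> x = 0"
    and infinite_initial_defect: "cdim (corthogonal_comp M) = \<infinity>"
    and infinite_final_defect: "cdim (corthogonal_comp (V ` M)) = \<infinity>"
begin

abbreviation "N \<equiv> corthogonal_comp M"
abbreviation "N' \<equiv> corthogonal_comp (V ` M)"

text \<open>For the Cayley transform of \<open>S\<close> this is the orthogonal complement of the domain of \<open>S\<close>, because
  \<open>x - V x = 2 i f\<close> for \<open>x = (S + i) f\<close>.\<close>

definition L :: "'a set" where
  "L = corthogonal_comp ((\<lambda>x. x - V x) ` M)"

lemma cinner_V:
  assumes "x \<in> M" "y \<in> M"
  shows "cinner (V x) (V y) = cinner x y"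
proof -
  have Re: "Re (cinner (V x) (V y)) = Re (cinner x y)" if "x \<in> M" for x
    using norm_add_square[of "V x" "V y"] norm_add_square[of x y] norm_V[of "x + y"] assms that
    by (simp add: V_add norm_V complex_vector.subspace_add[OF csubspace_M])
  have "Re (cinner (V (\<i> *\<^sub>C x)) (V y)) = Re (cinner (\<i> *\<^sub>C x) y)"
    by (intro Re complex_vector.subspace_scale[OF csubspace_M] assms)
  then have "Im (cinner (V x) (V y)) = Im (cinner x y)"
    using assms by (simp add: V_scaleC cinner_scaleC_left)
  then show ?thesis using Re assms by (simp add: complex_eq_iff)
qed

lemma cinner_V_L:
  assumes "a \<in> L" "x \<in> M"
  shows "cinner (V x) a = cinner x a" "cinner a (V x) = cinner a x"
proof -
  have "cinner a (x - V x) = 0" using assms by (auto simp: L_def mem_corthogonal_comp)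
  then show 1: "cinner a (V x) = cinner a x" by (simp add: cinner_diff_right)
  then show "cinner (V x) a = cinner x a" by (metis cinner_commute)
qed

text \<open>
  If \<open>a \<in> L\<close> and \<open>m\<close> is its projection to \<open>M\<close>, then \<open>V m\<close> is its projection to the range of \<open>V\<close>. The
  differences \<open>p = a - m\<close> and \<open>p' = a - V m\<close> lie in \<open>N\<close> and \<open>N'\<close>, have the same norm, and differ by
  \<open>m - V m\<close>, to which \<open>L\<close> is orthogonal; they are nonzero because \<open>V\<close> fixes no nonzero vector. If \<open>L\<close> is
  infinite-dimensional, this gives enough pairs. If \<open>L\<close> is finite-dimensional, there are unit vectors of
  \<open>N\<close> and of \<open>N'\<close> that are orthogonal to all of \<open>L\<close>.
\<close>

lemma paired_unit_vectors:
  assumes F: "finite F" "F \<subseteq> N \<times> N'" "\<And>k k' a. (k, k') \<in> F \<Longrightarrow> a \<in> L \<Longrightarrow> cinner a k = cinner a k'"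
  shows "\<exists>h\<in>N. \<exists>h'\<in>N'. norm h = 1 \<and> norm h' = 1 \<and> (\<forall>a\<in>L. cinner a h = cinner a h') \<and>
    (\<forall>(k, k')\<in>F. cinner h k = 0 \<and> cinner h' k' = 0)"
proof (cases "cdim L = \<infinity>")
  case True
  have "csubspace L" by (simp add: L_def)
  then obtain a where a: "a \<in> L" "norm a = 1" "\<And>k k'. (k, k') \<in> F \<Longrightarrow> cinner a k = 0"
    using unit_vector_orthogonal_to_finite_set[OF _ True, of "fst ` F"] F(1) by force
  define m p p' where "m = cproj M a" and "p = a - m" and "p' = a - V m"
  have m: "m \<in> M" by (simp add: m_def cproj_in csubspace_M closed_M)
  have pM: "cinner p y = 0" if "y \<in> M" for y
    using cproj_orthogonal[OF csubspace_M closed_M that] by (simp add: p_def m_def)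
  have p'M: "cinner p' (V y) = 0" if "y \<in> M" for y
    using pM[OF that] by (simp add: p_def p'_def cinner_diff_left cinner_V m that cinner_V_L a)
  have norms: "norm p' = norm p"
  proof -
    have "(norm p')\<^sup>2 = (norm p)\<^sup>2"
      by (simp add: p_def p'_def norm_diff_square cinner_V_L a m norm_V)
    then show ?thesis by simp
  qed
  have "p \<noteq> 0"
  proof
    assume "p = 0"
    with norms have "p' = 0" by simp
    then have "V m = m" "a = m" using \<open>p = 0\<close> by (simp_all add: p_def p'_def)
    then show False using V_fixpoint[OF m] a by simp
  qed
  have pN: "p \<in> N" and p'N: "p' \<in> N'" using pM p'M by (auto simp: mem_corthogonal_comp)
  have pL: "cinner b p = cinner b p'" if "b \<in> L" for b
    by (simp add: p_def p'_def cinner_diff_right cinner_V_L that m)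
  have pF: "cinner p k = 0" "cinner p' k' = 0" if kF: "(k, k') \<in> F" for k k'
  proof -
    have "cinner m k = 0" "cinner (V m) k' = 0"
      using kF F(2) m cinner_eq_0_commute by (fastforce simp: mem_corthogonal_comp)+
    moreover have "cinner a k' = 0" using F(3)[OF kF a(1)] a(3)[OF kF] by simp
    ultimately show "cinner p k = 0" "cinner p' k' = 0"
      using a(3)[OF kF] by (simp_all add: p_def p'_def cinner_diff_left)
  qed
  show ?thesis
  proof (intro bexI conjI)
    show "sgn p \<in> N" "sgn p' \<in> N'" by (auto intro!: csubspace_sgn pN p'N)
    show "norm (sgn p) = 1" "norm (sgn p') = 1"
      using \<open>p \<noteq> 0\<close> norms by (auto simp: norm_sgn)
    show "\<forall>a\<in>L. cinner a (sgn p) = cinner a (sgn p')"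
      by (simp add: sgn_div_norm cinner_scaleR_right norms pL)
    show "\<forall>(k, k')\<in>F. cinner (sgn p) k = 0 \<and> cinner (sgn p') k' = 0"
      by (auto simp: sgn_div_norm cinner_scaleR_left pF)
  qed
next
  case False
  then obtain B where B: "finite B" "L \<subseteq> complex_vector.span B"
    unfolding cdim_infinite_iff by blast
  have orthL: "cinner a x = 0" if "a \<in> L" "\<forall>b\<in>B. cinner x b = 0" for a x
  proof -
    have "complex_vector.span B \<subseteq> corthogonal_comp {x}"
      using that(2) cinner_eq_0_commute[of x]
      by (intro complex_vector.span_minimal) (auto simp: mem_corthogonal_comp)
    then show ?thesis using that(1) B(2) by (auto simp: mem_corthogonal_comp)
  qed
  obtain h where h: "h \<in> N" "norm h = 1" "\<forall>b\<in>fst ` F \<union> B. cinner h b = 0"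
    using unit_vector_orthogonal_to_finite_set[OF _ infinite_initial_defect, of "fst ` F \<union> B"] F B
    by auto
  obtain h' where h': "h' \<in> N'" "norm h' = 1" "\<forall>b\<in>snd ` F \<union> B. cinner h' b = 0"
    using unit_vector_orthogonal_to_finite_set[OF _ infinite_final_defect, of "snd ` F \<union> B"] F B
    by auto
  have "\<forall>a\<in>L. cinner a h = cinner a h'" using orthL h(3) h'(3) by simp
  moreover have "cinner h k = 0 \<and> cinner h' k' = 0" if "(k, k') \<in> F" for k k'
    using h(3) h'(3) that by force
  ultimately show ?thesis using h h' by blast
qed

lemma paired_orthonormal_sequences:
  "\<exists>h h'. orthonormal_or_zero h \<and> orthonormal_or_zero h' \<and>
    (\<forall>n::nat. h n \<in> N \<and> h' n \<in> N' \<and> norm (h n) = 1 \<and> norm (h' n) = 1 \<and>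
       (\<forall>a\<in>L. cinner a (h n) = cinner a (h' n)))"
proof -
  define P where "P f n r \<longleftrightarrow> fst r \<in> N \<and> snd r \<in> N' \<and> norm (fst r) = 1 \<and> norm (snd r) = 1 \<and>
       (\<forall>a\<in>L. cinner a (fst r) = cinner a (snd r)) \<and>
       (\<forall>j<n. cinner (fst r) (fst (f j)) = 0 \<and> cinner (snd r) (snd (f j)) = 0)"
    for f :: "nat \<Rightarrow> 'a \<times> 'a" and n :: nat and r
  have "\<exists>f. \<forall>n. P f n (f n)"
  proof (rule dependent_wellorder_choice)
    show "P f n r = P g n r" if "\<And>j. j < n \<Longrightarrow> f j = g j" for r f g n
      using that by (simp add: P_def)
    show "\<exists>r. P f n r" if f: "\<And>j. j < n \<Longrightarrow> P f j (f j)" for n f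
    proof -
      have "\<exists>h\<in>N. \<exists>h'\<in>N'. norm h = 1 \<and> norm h' = 1 \<and> (\<forall>a\<in>L. cinner a h = cinner a h') \<and>
        (\<forall>(k, k')\<in>f ` {..<n}. cinner h k = 0 \<and> cinner h' k' = 0)"
      proof (rule paired_unit_vectors)
        show "f ` {..<n} \<subseteq> N \<times> N'"
        proof (rule image_subsetI)
          show "f j \<in> N \<times> N'" if "j \<in> {..<n}" for j
            using f[of j] that by (simp add: P_def mem_Times_iff)
        qed
        show "cinner a k = cinner a k'" if k: "(k, k') \<in> f ` {..<n}" and a: "a \<in> L" for k k' a
        proof -
          obtain j where j: "j < n" "f j = (k, k')" using k by auto
          show ?thesis using f[OF j(1)] a by (simp add: P_def j(2))
        qed
      qed simp
      then obtain h h' where h: "h \<in> N" "h' \<in> N'" "norm h = 1" "norm h' = 1"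
        "\<forall>a\<in>L. cinner a h = cinner a h'"
        and orth: "\<forall>(k, k')\<in>f ` {..<n}. cinner h k = 0 \<and> cinner h' k' = 0" by blast
      have "cinner h (fst (f j)) = 0 \<and> cinner h' (snd (f j)) = 0" if "j < n" for j
        using bspec[OF orth, of "f j"] that by (simp add: case_prod_beta)
      then have "P f n (h, h')" using h by (simp add: P_def)
      then show ?thesis ..
    qed
  qed
  then obtain f where f: "\<And>n. P f n (f n)" by blast
  have less: "cinner (fst (f n)) (fst (f m)) = 0 \<and> cinner (snd (f n)) (snd (f m)) = 0"
    if "m < n" for m n
    using f[of n] that by (simp add: P_def)
  have orth: "cinner (fst (f m)) (fst (f n)) = 0" "cinner (snd (f m)) (snd (f n)) = 0"
    if "m \<noteq> n" for m n
    using that less[of m n] less[of n m] cinner_eq_0_commute by (metis nat_neq_iff)+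
  have "orthonormal_or_zero (\<lambda>n. fst (f n))" "orthonormal_or_zero (\<lambda>n. snd (f n))"
    unfolding orthonormal_or_zero_def using orth f by (simp_all add: P_def)
  moreover have "fst (f n) \<in> N \<and> snd (f n) \<in> N' \<and> norm (fst (f n)) = 1 \<and> norm (snd (f n)) = 1 \<and>
      (\<forall>a\<in>L. cinner a (fst (f n)) = cinner a (snd (f n)))" for n
    using f[of n] by (simp add: P_def)
  ultimately show ?thesis
    by (intro exI[of _ "\<lambda>n. fst (f n)"] exI[of _ "\<lambda>n. snd (f n)"]) simp
qed

text \<open>An orthonormal basis of \<open>N\<close> can be mapped to any orthonormal sequence of \<open>N'\<close>.\<close>

lemma isometric_extension:
  assumes e: "orthonormal_or_zero e" "\<And>n. e n \<in> N"
    and complete: "\<And>z. z \<in> N \<Longrightarrow> (\<And>n. cinner z (e n) = 0) \<Longrightarrow> z = 0"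
    and f: "orthonormal_or_zero f" "\<And>n. norm (f n) = 1" "\<And>n. f n \<in> N'"
  shows "\<exists>U. (\<forall>x y. U (x + y) = U x + U y) \<and> (\<forall>c x. U (c *\<^sub>C x) = c *\<^sub>C U x) \<and>
    (\<forall>x. norm (U x) = norm x) \<and> (\<forall>x\<in>M. U x = V x) \<and> (\<forall>n. norm (e n) = 1 \<longrightarrow> U (e n) = f n)"
proof -
  define K where "K x = (\<Sum>n. cinner x (e n) *\<^sub>C f n)" for x
  define U where "U x = V (cproj M x) + K x" for x
  note M = csubspace_M closed_M
  note c = summable_bessel[OF e(1)]
  have sK: "summable (\<lambda>n. cinner x (e n) *\<^sub>C f n)" for x
    by (rule summable_orthogonal_series[OF f(1) c])
  have P_in: "cproj M x \<in> M" for x by (rule cproj_in[OF M])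
  have "K (x + y) = K x + K y" for x y
    using suminf_add[OF sK[of x] sK[of y]] by (simp add: K_def cinner_add_left scaleC_add_left)
  then have "U (x + y) = U x + U y" for x y
    by (simp add: U_def cproj_add[OF M] V_add[OF P_in P_in])
  moreover have "K (a *\<^sub>C x) = a *\<^sub>C K x" for a x
    using bounded_linear.suminf[OF bounded_linear_scaleC_right sK[of x], of a]
    by (simp add: K_def cinner_scaleC_left scaleC_scaleC)
  then have "U (a *\<^sub>C x) = a *\<^sub>C U x" for a x
    by (simp add: U_def cproj_scaleC[OF M] V_scaleC[OF P_in] scaleC_add_right)
  moreover have "norm (U x) = norm x" for x
  proof -
    define p where "p = cproj M x"
    define s where "s = (\<Sum>n. cinner x (e n) *\<^sub>C e n)"
    have p: "p \<in> M" by (simp add: p_def P_in)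
    have xp: "x - p \<in> N" by (simp add: p_def mem_corthogonal_comp cproj_orthogonal[OF M])
    \<comment> \<open>The basis expansion of the component of \<open>x\<close> in \<open>N\<close>.\<close>
    have "x - p - s = 0"
    proof (rule complete)
      have "cinner s y = 0" if "y \<in> M" for y
      proof -
        have "(\<lambda>n. cinner x (e n) * cinner (e n) y) = (\<lambda>n. 0)"
          using e(2) that by (auto simp: mem_corthogonal_comp)
        then show ?thesis
          using cinner_orthogonal_series[OF e(1) c, of x y] sums_unique2 sums_zero
          by (metis s_def)
      qed
      then show "x - p - s \<in> N" using xp by (simp add: mem_corthogonal_comp cinner_diff_left)
      have "cinner p (e n) = 0" for n
        using e(2) p cinner_eq_0_commute by (auto simp: mem_corthogonal_comp)
      then show "cinner (x - p - s) (e n) = 0" for n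
        by (simp add: cinner_diff_left s_def cinner_orthogonal_series_coefficient[OF e(1) c]
            cinner_norm_0_or_1[OF e(1)] del: of_real_power)
    qed
    then have s: "s = x - p" by simp
    have "(\<lambda>n. (cmod (cinner x (e n)))\<^sup>2 * (norm (e n))\<^sup>2) = (\<lambda>n. (cmod (cinner x (e n)))\<^sup>2)"
    proof
      show "(cmod (cinner x (e n)))\<^sup>2 * (norm (e n))\<^sup>2 = (cmod (cinner x (e n)))\<^sup>2" for n
        using e(1) by (cases "e n = 0") (auto simp: orthonormal_or_zero_def)
    qed
    then have "(\<lambda>n. (cmod (cinner x (e n)))\<^sup>2) sums (norm (x - p))\<^sup>2"
      using norm_orthogonal_series[OF e(1) c, of x] by (simp add: s[symmetric] s_def)
    moreover have "(\<lambda>n. (cmod (cinner x (e n)))\<^sup>2) sums (norm (K x))\<^sup>2"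
      using norm_orthogonal_series[OF f(1) c, of x] by (simp add: K_def f(2))
    ultimately have K: "(norm (K x))\<^sup>2 = (norm (x - p))\<^sup>2" using sums_unique2 by blast
    have "(\<lambda>n. cinner x (e n) * cinner (f n) (V p)) = (\<lambda>n. 0)"
      using f(3) p by (auto simp: mem_corthogonal_comp)
    then have "cinner (K x) (V p) = 0"
      using cinner_orthogonal_series[OF f(1) c, of x "V p"] sums_unique2 sums_zero
      by (metis K_def)
    then have "(norm (U x))\<^sup>2 = (norm p)\<^sup>2 + (norm (x - p))\<^sup>2"
      using norm_add_square[of "K x" "V p"] K
      by (simp add: U_def add.commute p_def[symmetric] norm_V p)
    then have "(norm (U x))\<^sup>2 = (norm x)\<^sup>2" using norm_cproj_decompose[OF M, of x] by (simp add: p_def)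
    then show ?thesis by simp
  qed
  moreover have "U x = V x" if x: "x \<in> M" for x
  proof -
    have "cinner x (e n) = 0" for n
      using e(2) x cinner_eq_0_commute by (auto simp: mem_corthogonal_comp)
    then show ?thesis by (simp add: U_def K_def cproj_self[OF M x])
  qed
  moreover have "U (e m) = f m" if em: "norm (e m) = 1" for m
  proof -
    have "(\<lambda>n. cinner (e m) (e n) *\<^sub>C f n) = (\<lambda>n. if n = m then f m else 0)"
      using e(1) em by (auto simp: orthonormal_or_zero_def cinner_self scaleC_one)
    then have "K (e m) = f m"
      using sums_single[of m "\<lambda>_. f m"] by (simp add: K_def sums_unique[symmetric])
    moreover have "cproj M (e m) = 0"
      by (rule cproj_unique[OF M])
        (use e(2)[of m] complex_vector.subspace_0[OF csubspace_M] in \<open>auto simp: mem_corthogonal_comp\<close>)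
    moreover have "V 0 = 0" using V_scaleC[of 0 0] complex_vector.subspace_0[OF csubspace_M] by simp
    ultimately show ?thesis by (simp add: U_def)
  qed
  ultimately show ?thesis by (intro exI[of _ U]) blast
qed

text \<open>
  The pairing function splits \<open>h\<close> and \<open>h'\<close> into infinitely many families each, and \<open>U\<close> shifts
  every family: member \<open>k\<close> of a family of \<open>h\<close>, that is \<open>H i k\<close>, goes to member \<open>k + 1\<close> of the family
  of \<open>h'\<close> with the same number \<open>i\<close>. This leaves the members \<open>0\<close> of the families of \<open>h'\<close> free as images of an orthonormal basis \<open>g\<close> of the rest of \<open>N\<close>, of whatever dimension
  that rest is. The basis \<open>e\<close> of \<open>N\<close> collects both kinds of vectors, indexed by their images. The vectors
  \<open>v j\<close> are members of \<open>e\<close>, each occurring infinitely often, perturbed by multiples of vectors \<open>y j\<close>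
  whose coefficients in the family \<open>H j\<close> are harmonic. Along the repetitions of one member of \<open>e\<close> the
  perturbations tend to \<open>0\<close>, so that the \<open>v j\<close> still span a dense subspace of \<open>N\<close>.
\<close>

lemma isometric_extension_with_dense_differences:
  fixes q :: "nat \<Rightarrow> 'a"
  assumes q: "closure (range q) = UNIV"
  obtains U and v :: "nat \<Rightarrow> 'a"
  where "\<And>x y. U (x + y) = U x + U y" "\<And>c x. U (c *\<^sub>C x) = c *\<^sub>C U x" "\<And>x. norm (U x) = norm x"
    "\<And>x. x \<in> M \<Longrightarrow> U x = V x" "\<And>x. (\<forall>j. cinner x (v j) = 0) \<longleftrightarrow> x \<in> M"
    "\<And>J. closure ((\<lambda>x. x - U x) ` {x. \<forall>j<J. cinner x (v j) = 0}) = UNIV"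
proof -
  obtain h h' where h: "orthonormal_or_zero h" "orthonormal_or_zero h'"
    "\<And>n. h n \<in> N" "\<And>n. h' n \<in> N'" "\<And>n. norm (h n) = 1" "\<And>n. norm (h' n) = 1"
    and hL: "\<And>n a. a \<in> L \<Longrightarrow> cinner a (h n) = cinner a (h' n)"
    using paired_orthonormal_sequences by blast
  obtain g where g: "orthonormal_or_zero g" "\<And>n. g n \<in> corthogonal_comp (M \<union> range h)"
    and g_complete: "\<And>z n. z \<in> corthogonal_comp (M \<union> range h) \<Longrightarrow> (\<And>n. cinner z (g n) = 0) \<Longrightarrow>
      cinner z (q n) = 0"
    using gram_schmidt_in_orthogonal_complement[of "M \<union> range h" q] by blast
  define H where "H i k = h (prod_encode (k, i))" for i k
  define e where "e n = (case prod_decode n of (0, i) \<Rightarrow> g i | (Suc k, i) \<Rightarrow> H i k)" for n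
  have e_g: "e (prod_encode (0, i)) = g i" and e_H: "e (prod_encode (Suc k, i)) = H i k" for i k
    by (simp_all add: e_def)
  have e_cases: "(\<exists>i. n = prod_encode (0, i)) \<or> (\<exists>i k. n = prod_encode (Suc k, i))" for n
    by (metis not0_implies_Suc prod_decode_inverse surj_pair)
  have H_orth: "cinner (H i k) (H i' k') = (if i = i' \<and> k = k' then 1 else 0)" for i k i' k'
    using h(1,5) by (auto simp: H_def orthonormal_or_zero_def cinner_self)
  have gM: "g i \<in> N" and g_H: "cinner (g i) (H i' k) = 0" "cinner (H i' k) (g i) = 0" for i i' k
    using g(2)[of i] cinner_eq_0_commute by (auto simp: mem_corthogonal_comp H_def)
  have HN: "H i k \<in> N" for i k by (simp add: H_def h)
  have H_oz: "orthonormal_or_zero (H i)" for i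
    using H_orth h(5) by (auto simp: orthonormal_or_zero_def H_def)
  have e_oz: "orthonormal_or_zero e"
    unfolding orthonormal_or_zero_def
  proof (intro conjI allI impI)
    show "cinner (e m) (e n) = 0" if "m \<noteq> n" for m n
      using e_cases[of m] e_cases[of n] that g(1)
      by (auto simp: e_g e_H g_H H_orth orthonormal_or_zero_def)
    show "norm (e n) = 0 \<or> norm (e n) = 1" for n
      using e_cases[of n] g(1) h(5) by (auto simp: e_g e_H H_def orthonormal_or_zero_def)
  qed
  have eN: "e n \<in> N" for n using e_cases[of n] gM HN by (auto simp: e_g e_H)
  have e_complete: "z = 0" if z: "z \<in> N" "\<And>n. cinner z (e n) = 0" for z
  proof (rule orthogonal_to_dense_sequence[OF q], rule g_complete)
    have "cinner z (h n) = 0" for n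
      using z(2)[of "prod_encode (Suc (fst (prod_decode n)), snd (prod_decode n))"]
      by (simp add: e_H H_def)
    then show "z \<in> corthogonal_comp (M \<union> range h)" using z(1) by (auto simp: mem_corthogonal_comp)
    show "cinner z (g n) = 0" for n using z(2)[of "prod_encode (0, n)"] by (simp add: e_g)
  qed
  obtain U where U: "\<And>x y. U (x + y) = U x + U y" "\<And>c x. U (c *\<^sub>C x) = c *\<^sub>C U x"
    "\<And>x. norm (U x) = norm x" "\<And>x. x \<in> M \<Longrightarrow> U x = V x"
    and Ue: "\<And>n. norm (e n) = 1 \<Longrightarrow> U (e n) = h' n"
    using isometric_extension[OF e_oz eN e_complete h(2,6,4)] by blast
  define c where "c k = complex_of_real (1 / real (Suc k))" for k
  define y where "y i = (\<Sum>k. c k *\<^sub>C H i k)" for i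
  have c_sq: "summable (\<lambda>k. (cmod (c k))\<^sup>2)"
  proof -
    have "summable (\<lambda>k. 1 / (real (Suc k))\<^sup>2)"
      using inverse_power_summable[of 2, where 'a = real]
      by (subst summable_Suc_iff) (simp add: field_simps)
    then show ?thesis by (simp add: c_def norm_divide power_divide del: of_nat_Suc)
  qed
  have H_y: "cinner (H i k) (y j) = (if i = j then c k else 0)" for i j k
  proof (cases "i = j")
    case True
    have "cinner (y i) (H i k) = c k"
      using cinner_orthogonal_series_coefficient[OF H_oz c_sq, of i k] by (simp add: y_def h(5) H_def)
    then show ?thesis using True cinner_commute[of "H i k" "y i"] by (simp add: c_def)
  next
    case False
    then have "cinner (y j) (H i k) = 0"
      using cinner_orthogonal_series[OF H_oz c_sq, of j "H i k"] sums_unique2[OF _ sums_zero]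
      by (simp add: y_def H_orth)
    then show ?thesis using False cinner_eq_0_commute by auto
  qed
  have y_orth: "cinner z (y j) = 0" if "\<And>k. cinner (H j k) z = 0" for j z
  proof -
    have "cinner (y j) z = 0"
      using cinner_orthogonal_series[OF H_oz c_sq, of j z] sums_unique2[OF _ sums_zero]
      by (simp add: y_def that)
    then show ?thesis using cinner_eq_0_commute by blast
  qed
  define C where "C = norm (y 0)"
  have norm_y: "norm (y i) = C" for i
  proof -
    have "(\<lambda>n. (cmod (c n))\<^sup>2) sums (norm (y i))\<^sup>2" for i
      using norm_orthogonal_series[OF H_oz c_sq, of i] by (simp add: y_def H_def h(5))
    then have "(norm (y i))\<^sup>2 = (norm (y 0))\<^sup>2" using sums_unique2 by blast
    then show ?thesis by (simp add: C_def)
  qed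
  define v where "v j = e (fst (prod_decode j)) + c (snd (prod_decode j)) *\<^sub>C y j" for j
  have v_iff: "(\<forall>j. cinner x (v j) = 0) \<longleftrightarrow> x \<in> M" for x
  proof
    assume "x \<in> M"
    then have "cinner x z = 0" if "z \<in> N" for z
      using that cinner_eq_0_commute by (auto simp: mem_corthogonal_comp)
    moreover have "cinner x (y j) = 0" for j
    proof (rule y_orth)
      show "cinner (H j k) x = 0" for k
        using HN[of j k] \<open>x \<in> M\<close> by (auto simp: mem_corthogonal_comp)
    qed
    ultimately show "\<forall>j. cinner x (v j) = 0"
      using eN by (simp add: v_def cinner_linear_simps)
  next
    assume x: "\<forall>j. cinner x (v j) = 0"
    have "cinner x (e n) = 0" for n
    proof -
      have "cmod (cinner x (e n)) \<le> (norm x * C) * inverse (real (Suc l))" for l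
      proof -
        let ?j = "prod_encode (n, l)"
        have "cinner x (v ?j) = cinner x (e n) + c l * cinner x (y ?j)"
          by (simp add: v_def cinner_linear_simps c_def)
        then have "cinner x (e n) = - (c l * cinner x (y ?j))"
          using x by (simp add: eq_neg_iff_add_eq_0)
        then have "cmod (cinner x (e n)) = cmod (c l) * cmod (cinner x (y ?j))"
          by (simp add: norm_mult)
        also have "\<dots> \<le> cmod (c l) * (norm x * C)"
          using norm_cinner_le[of x "y ?j"] by (intro mult_left_mono) (auto simp: norm_y)
        finally show ?thesis
          by (simp add: c_def norm_divide inverse_eq_divide mult.commute del: of_nat_Suc)
      qed
      moreover have "(\<lambda>l. (norm x * C) * inverse (real (Suc l))) \<longlonglongrightarrow> (norm x * C) * 0"
        by (intro tendsto_mult tendsto_const LIMSEQ_inverse_real_of_nat)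
      ultimately have "cmod (cinner x (e n)) \<le> (norm x * C) * 0"
        by (intro LIMSEQ_le_const) auto
      then show ?thesis by simp
    qed
    moreover have "cinner (cproj M x) (e n) = 0" for n
      using eN[of n] cproj_in[OF csubspace_M closed_M, of x] cinner_eq_0_commute
      by (auto simp: mem_corthogonal_comp)
    ultimately have "x - cproj M x = 0"
      using cproj_orthogonal[OF csubspace_M closed_M, of _ x]
      by (intro e_complete) (auto simp: mem_corthogonal_comp cinner_diff_left)
    then show "x \<in> M" using cproj_in[OF csubspace_M closed_M, of x] by simp
  qed
  \<comment> \<open>A vector \<open>a\<close> that obstructs density lies in \<open>L\<close>; the harmonic parts of the \<open>v j\<close> then show that
    \<open>\<phi> = 0\<close>, and the shifts that \<open>a = 0\<close>.\<close>
  have "closure ((\<lambda>x. x - U x) ` {x. \<forall>j<J. cinner x (v j) = 0}) = UNIV" for J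
  proof (rule dense_if_corthogonal_comp_trivial)
    have "csubspace {x. \<forall>j<J. cinner x (v j) = 0}"
      by (rule complex_vector.subspaceI) (auto simp: cinner_linear_simps)
    then show "csubspace ((\<lambda>x. x - U x) ` {x. \<forall>j<J. cinner x (v j) = 0})"
      by (rule csubspace_image) (simp_all add: U complex_vector.scale_right_diff_distrib)
  next
    fix a assume a: "\<And>z. z \<in> (\<lambda>x. x - U x) ` {x. \<forall>j<J. cinner x (v j) = 0} \<Longrightarrow> cinner z a = 0"
    define \<phi> where "\<phi> x = cinner (x - U x) a" for x
    have "\<exists>d. \<forall>x. \<phi> x = (\<Sum>j<J. d j * cinner x (v j))"
    proof (rule functional_vanishing_on_orthogonal_complement)
      show "\<phi> x = 0" if "\<And>j. j < J \<Longrightarrow> cinner x (v j) = 0" for x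
        unfolding \<phi>_def by (rule a) (use that in blast)
    qed (auto simp: \<phi>_def U cinner_linear_simps algebra_simps)
    then obtain d where d: "\<And>x. \<phi> x = (\<Sum>j<J. d j * cinner x (v j))" by blast
    have \<phi>M: "cinner (x - V x) a = 0" if "x \<in> M" for x
      using d[of x] v_iff[of x] that by (simp add: \<phi>_def U)
    then have aL: "a \<in> L" using cinner_eq_0_commute by (auto simp: L_def mem_corthogonal_comp)
    have hh': "cinner (h' n) a = cinner (h n) a" for n
      using hL[OF aL, of n] cinner_commute by metis
    define \<alpha> where "\<alpha> i k = cinner (H i k) a" for i k
    have \<phi>H: "\<phi> (H i k) = \<alpha> i k - \<alpha> i (Suc k)" for i k
    proof -
      have "U (H i k) = h' (prod_encode (Suc k, i))"
        using Ue[of "prod_encode (Suc k, i)"] by (simp add: e_H H_def h(5))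
      then show ?thesis by (simp add: \<phi>_def cinner_diff_left hh' \<alpha>_def H_def)
    qed
    have \<alpha>_lim: "\<alpha> i \<longlonglongrightarrow> 0" for i
      unfolding \<alpha>_def by (rule orthonormal_sequence_weakly_null[OF H_oz])
    have d0: "d i = 0" if i: "i < J" for i
    proof -
      have "\<alpha> i k - \<alpha> i (Suc k) = (d i * c (snd (prod_decode i))) / of_nat (Suc k)"
        if k: "k \<ge> J" for k
      proof -
        have v: "cinner (H i k) (v j) = (if j = i then c (snd (prod_decode i)) * c k else 0)"
          if j: "j < J" for j
        proof -
          \<comment> \<open>For \<open>k \<ge> J\<close> the basis member in \<open>v j\<close> has an index too small to be \<open>H i k\<close>, so only the
            harmonic part contributes.\<close>
          have "fst (prod_decode j) \<le> j"
            using le_prod_encode_1[of "fst (prod_decode j)" "snd (prod_decode j)"] by simp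
          moreover have "k < prod_encode (Suc k, i)"
            using le_prod_encode_1[of "Suc k" i] by simp
          ultimately have "prod_encode (Suc k, i) \<noteq> fst (prod_decode j)" using j k by linarith
          then have "cinner (H i k) (e (fst (prod_decode j))) = 0"
            using e_oz e_H[of k i] unfolding orthonormal_or_zero_def by metis
          then show ?thesis by (simp add: v_def cinner_linear_simps H_y c_def)
        qed
        have "\<alpha> i k - \<alpha> i (Suc k) = (\<Sum>j<J. d j * cinner (H i k) (v j))"
          using \<phi>H d by metis
        also have "\<dots> = (\<Sum>j<J. if j = i then d i * (c (snd (prod_decode i)) * c k) else 0)"
          by (intro sum.cong) (auto simp: v)
        also have "\<dots> = d i * (c (snd (prod_decode i)) * c k)" using i by simp
        finally show ?thesis by (simp add: c_def)
      qed
      then have "d i * c (snd (prod_decode i)) = 0"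
        by (rule harmonic_increments_not_convergent[OF \<alpha>_lim])
      then show ?thesis by (simp add: c_def del: of_nat_Suc)
    qed
    have \<phi>0: "\<phi> x = 0" for x using d[of x] d0 by simp
    have "\<alpha> i k = 0" for i k
    proof -
      have "\<alpha> i k = \<alpha> i 0" for k
        using \<phi>H \<phi>0 by (induction k) (metis eq_iff_diff_eq_0)+
      then have "\<alpha> i = (\<lambda>k. \<alpha> i 0)" by auto
      then have "\<alpha> i 0 = 0" using \<alpha>_lim[of i] LIMSEQ_unique tendsto_const by metis
      then show ?thesis using \<open>\<And>k. \<alpha> i k = \<alpha> i 0\<close> by simp
    qed
    then have Ha: "cinner (H i k) a = 0" for i k by (simp add: \<alpha>_def)
    have ha: "cinner (h n) a = 0" for n
      using Ha[of "snd (prod_decode n)" "fst (prod_decode n)"] by (simp add: H_def)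
    have ga: "cinner (g i) a = 0" for i
    proof (cases "g i = 0")
      case False
      then have "norm (e (prod_encode (0, i))) = 1"
        using g(1) by (auto simp: orthonormal_or_zero_def e_g)
      then have "U (g i) = h' (prod_encode (0, i))" using Ue e_g by metis
      then show ?thesis using \<phi>0[of "g i"] by (simp add: \<phi>_def cinner_diff_left hh' ha)
    qed simp
    have "a - cproj M a = 0"
    proof (rule e_complete)
      show "a - cproj M a \<in> N"
        by (simp add: mem_corthogonal_comp cproj_orthogonal[OF csubspace_M closed_M])
      show "cinner (a - cproj M a) (e n) = 0" for n
      proof -
        have "cinner (e n) a = 0" using e_cases[of n] ga Ha by (auto simp: e_g e_H)
        moreover have "cinner (e n) (cproj M a) = 0"
          using eN[of n] cproj_in[OF csubspace_M closed_M, of a] by (auto simp: mem_corthogonal_comp)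
        ultimately show ?thesis using cinner_eq_0_commute by (metis cinner_diff_right diff_self)
      qed
    qed
    then have aM: "a \<in> M" using cproj_in[OF csubspace_M closed_M, of a] by simp
    have "cinner (V a) a = cinner a a" using \<phi>M[OF aM] by (simp add: cinner_diff_left)
    then have "(norm (V a - a))\<^sup>2 = 0"
      by (simp add: norm_diff_square norm_V[OF aM] cinner_self del: of_real_power)
    then show "a = 0" using V_fixpoint[OF aM] by simp
  qed
  with U v_iff show thesis by (rule that[of U v])
qed

end

section \<open>Perturbing an isometry into a contraction\<close>

lemma summable_small_quadratic_form:
  fixes v :: "nat \<Rightarrow> 'a::complex_inner"
  assumes t: "\<And>j. 0 \<le> t j" "\<And>j. t j * (norm (v j))\<^sup>2 \<le> (1/2) ^ Suc j"
  shows "summable (\<lambda>j. t j * (cmod (cinner x (v j)))\<^sup>2)"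
    and "(\<Sum>j. t j * (cmod (cinner x (v j)))\<^sup>2) \<le> (norm x)\<^sup>2"
proof -
  have le: "t j * (cmod (cinner x (v j)))\<^sup>2 \<le> (norm x)\<^sup>2 * (1/2) ^ Suc j" for j
  proof -
    have "(cmod (cinner x (v j)))\<^sup>2 \<le> (norm x)\<^sup>2 * (norm (v j))\<^sup>2"
      using power_mono[OF norm_cinner_le[of x "v j"], of 2] by (simp add: power_mult_distrib)
    then have "t j * (cmod (cinner x (v j)))\<^sup>2 \<le> t j * ((norm x)\<^sup>2 * (norm (v j))\<^sup>2)"
      by (rule mult_left_mono[OF _ t(1)])
    also have "\<dots> = (norm x)\<^sup>2 * (t j * (norm (v j))\<^sup>2)" by simp
    also have "\<dots> \<le> (norm x)\<^sup>2 * (1/2) ^ Suc j" by (rule mult_left_mono[OF t(2)]) simp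
    finally show ?thesis .
  qed
  have s: "(\<lambda>j. (norm x)\<^sup>2 * (1/2) ^ Suc j) sums (norm x)\<^sup>2"
    using sums_mult[OF power_half_series, of "(norm x)\<^sup>2"] by simp
  show "summable (\<lambda>j. t j * (cmod (cinner x (v j)))\<^sup>2)"
    by (rule summable_comparison_test[OF _ sums_summable[OF s]]) (use le t(1) in auto)
  then show "(\<Sum>j. t j * (cmod (cinner x (v j)))\<^sup>2) \<le> (norm x)\<^sup>2"
    using suminf_le[OF le _ sums_summable[OF s]] sums_unique[OF s] by simp
qed

text \<open>The operator \<open>B x = (\<Sum>j. t j (x, v j) v j)\<close> has quadratic form \<open>\<beta>\<close> and satisfies \<open>0 \<le> B \<le> 1\<close>,
  so \<open>B\<^sup>2 \<le> B\<close>. In terms of \<open>\<beta>\<close> this is \<open>\<parallel>B x\<parallel>\<^sup>2 \<le> \<beta> x\<close>, which follows from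
  \<open>\<parallel>B x\<parallel>\<^sup>2 = (B x, B x) \<le> (\<beta> x + \<beta> (B x)) / 2\<close> and \<open>\<beta> z \<le> \<parallel>z\<parallel>\<^sup>2\<close>.\<close>

lemma small_positive_operator:
  fixes v :: "nat \<Rightarrow> 'a::complex_hilbert_space"
  assumes t: "\<And>j. 0 \<le> t j" "\<And>j. t j * (norm (v j))\<^sup>2 \<le> (1/2) ^ Suc j"
  defines "\<beta> \<equiv> \<lambda>x. \<Sum>j. t j * (cmod (cinner x (v j)))\<^sup>2"
  shows "\<exists>B. (\<forall>x y. B (x + y) = B x + B y) \<and> (\<forall>c x. B (c *\<^sub>C x) = c *\<^sub>C B x) \<and>
    (\<forall>x. (norm (B x))\<^sup>2 \<le> \<beta> x \<and> (norm (x - B x))\<^sup>2 = (norm x)\<^sup>2 - 2 * \<beta> x + (norm (B x))\<^sup>2)"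
proof -
  define b where "b x j = (of_real (t j) * cinner x (v j)) *\<^sub>C v j" for x j
  define B where "B x = suminf (b x)" for x
  note q = summable_small_quadratic_form[where t = t and v = v, OF t]
  have sb: "summable (b x)" for x
  proof (rule summable_comparison_test)
    have "norm (b x j) \<le> norm x * (1/2) ^ Suc j" for j
    proof -
      have "norm (b x j) = t j * (cmod (cinner x (v j)) * norm (v j))"
        by (simp add: b_def norm_scaleC norm_mult t(1))
      also have "\<dots> \<le> t j * ((norm x * norm (v j)) * norm (v j))"
        by (intro mult_left_mono mult_right_mono norm_cinner_le t) simp
      also have "\<dots> = norm x * (t j * (norm (v j))\<^sup>2)" by (simp add: power2_eq_square)
      also have "\<dots> \<le> norm x * (1/2) ^ Suc j" by (rule mult_left_mono[OF t(2)]) simp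
      finally show ?thesis .
    qed
    then show "\<exists>N. \<forall>n\<ge>N. norm (b x n) \<le> norm x * (1/2) ^ Suc n" by blast
    show "summable (\<lambda>j. norm x * (1/2) ^ Suc j)"
      by (rule summable_mult[OF sums_summable[OF power_half_series]])
  qed
  have inner: "(\<lambda>j. of_real (t j) * (cinner x (v j) * cinner (v j) z)) sums cinner (B x) z" for x z
    using bounded_linear.sums[OF bounded_linear_cinner_left summable_sums[OF sb[of x]], of z]
    by (simp add: B_def b_def cinner_scaleC_left mult.assoc)
  have "b (x + y) = (\<lambda>j. b x j + b y j)" for x y
    by (rule ext) (simp add: b_def cinner_add_left distrib_left scaleC_add_left)
  then have "B (x + y) = B x + B y" for x y
    using suminf_add[OF sb[of x] sb[of y]] by (simp add: B_def)
  moreover have "b (c *\<^sub>C x) = (\<lambda>j. c *\<^sub>C b x j)" for c x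
    by (rule ext) (simp add: b_def cinner_scaleC_left scaleC_scaleC mult.left_commute)
  then have "B (c *\<^sub>C x) = c *\<^sub>C B x" for c x
    using bounded_linear.suminf[OF bounded_linear_scaleC_right sb[of x], of c] by (simp add: B_def)
  moreover have B_le: "(norm (B x))\<^sup>2 \<le> \<beta> x" for x
  proof -
    have "(\<lambda>j. Re (of_real (t j) * (cinner x (v j) * cinner (v j) (B x)))) sums (norm (B x))\<^sup>2"
      using bounded_linear.sums[OF bounded_linear_Re inner[of x "B x"]]
      by (simp add: cinner_self del: of_real_power)
    moreover have "(\<lambda>j. (t j * (cmod (cinner x (v j)))\<^sup>2 + t j * (cmod (cinner (B x) (v j)))\<^sup>2) / 2)
        sums ((\<beta> x + \<beta> (B x)) / 2)"
      unfolding \<beta>_def by (intro sums_divide sums_add summable_sums q)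
    moreover have "Re (of_real (t j) * (cinner x (v j) * cinner (v j) (B x)))
        \<le> (t j * (cmod (cinner x (v j)))\<^sup>2 + t j * (cmod (cinner (B x) (v j)))\<^sup>2) / 2" for j
    proof -
      have eq: "cmod (cinner (v j) (B x)) = cmod (cinner (B x) (v j))"
        by (subst cinner_commute) simp
      have "Re (of_real (t j) * (cinner x (v j) * cinner (v j) (B x)))
          \<le> cmod (of_real (t j) * (cinner x (v j) * cinner (v j) (B x)))" by (rule complex_Re_le_cmod)
      also have "\<dots> = t j * (cmod (cinner x (v j)) * cmod (cinner (B x) (v j)))"
        by (simp add: norm_mult t(1) eq)
      also have "\<dots> \<le> t j * (((cmod (cinner x (v j)))\<^sup>2 + (cmod (cinner (B x) (v j)))\<^sup>2) / 2)"
        using sum_squares_bound[of "cmod (cinner x (v j))" "cmod (cinner (B x) (v j))"]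
        by (intro mult_left_mono t) simp
      finally show ?thesis by (simp add: distrib_left)
    qed
    ultimately have "(norm (B x))\<^sup>2 \<le> (\<beta> x + \<beta> (B x)) / 2" by (rule sums_le[rotated 1])
    moreover have "\<beta> (B x) \<le> (norm (B x))\<^sup>2" unfolding \<beta>_def by (rule q)
    ultimately show ?thesis by simp
  qed
  moreover have "(norm (x - B x))\<^sup>2 = (norm x)\<^sup>2 - 2 * \<beta> x + (norm (B x))\<^sup>2" for x
  proof -
    have re: "Re (of_real (t j) * (cinner x (v j) * cinner (v j) x)) = t j * (cmod (cinner x (v j)))\<^sup>2" for j
    proof -
      have "cinner x (v j) * cinner (v j) x = of_real ((cmod (cinner x (v j)))\<^sup>2)"
        unfolding complex_norm_square by (subst cinner_commute[of "v j" x]) (rule refl)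
      then show ?thesis by simp
    qed
    then have "(\<lambda>j. t j * (cmod (cinner x (v j)))\<^sup>2) sums Re (cinner (B x) x)"
      using bounded_linear.sums[OF bounded_linear_Re inner[of x x]] by (simp only: re)
    then have "Re (cinner (B x) x) = \<beta> x" by (simp add: \<beta>_def sums_unique)
    then have "Re (cinner x (B x)) = \<beta> x" by (subst cinner_commute) simp
    then show ?thesis by (simp add: norm_diff_square)
  qed
  ultimately show ?thesis by (intro exI[of _ B]) blast
qed

text \<open>
  The approximants \<open>r n J\<close>, with \<open>x - U x\<close> within \<open>1 / (J + 1)\<close> of \<open>q n\<close> and \<open>x\<close> orthogonal to \<open>v j\<close> for
  \<open>j < J\<close>, involve only \<open>U\<close>. So \<open>t j\<close> may be chosen after them, small relative to all \<open>r n i\<close> with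
  \<open>n, i \<le> j\<close>. Then \<open>\<beta> (r n J)\<close> has no terms before \<open>J\<close>, and is at most \<open>1 / 2 ^ J\<close> when \<open>n \<le> J\<close>.
\<close>

lemma contraction_with_singular_defect:
  fixes U :: "'a::complex_hilbert_space \<Rightarrow> 'a" and q v :: "nat \<Rightarrow> 'a"
  assumes U: "\<And>x y. U (x + y) = U x + U y" "\<And>c x. U (c *\<^sub>C x) = c *\<^sub>C U x" "\<And>x. norm (U x) = norm x"
    and dense: "\<And>J. closure ((\<lambda>x. x - U x) ` {x. \<forall>j<J. cinner x (v j) = 0}) = UNIV"
    and q: "closure (range q) = UNIV"
  obtains W where "\<And>x y. W (x + y) = W x + W y" "\<And>c x. W (c *\<^sub>C x) = c *\<^sub>C W x"
    "\<And>x. \<forall>j. cinner x (v j) = 0 \<Longrightarrow> W x = U x" "\<And>x. norm (W x) \<le> norm x"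
    "\<And>x. norm (W x) = norm x \<Longrightarrow> \<forall>j. cinner x (v j) = 0"
    "\<And>y \<epsilon>. \<epsilon> > 0 \<Longrightarrow> \<exists>x. norm (x - W x - y) < \<epsilon> \<and> (norm x)\<^sup>2 - (norm (W x))\<^sup>2 < \<epsilon>"
proof -
  have "\<exists>x. (\<forall>j<J. cinner x (v j) = 0) \<and> norm (x - U x - q n) < inverse (real (Suc J))" for n J
  proof -
    have pos: "inverse (real (Suc J)) > 0" by simp
    have "q n \<in> closure ((\<lambda>x. x - U x) ` {x. \<forall>j<J. cinner x (v j) = 0})" using dense by simp
    then obtain z where "z \<in> (\<lambda>x. x - U x) ` {x. \<forall>j<J. cinner x (v j) = 0}"
      "dist z (q n) < inverse (real (Suc J))"
      unfolding closure_approachable using pos by blast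
    then show ?thesis by (auto simp: dist_norm)
  qed
  then have "\<exists>r. \<forall>n J. (\<forall>j<J. cinner (r n J) (v j) = 0) \<and>
      norm (r n J - U (r n J) - q n) < inverse (real (Suc J))"
    by (intro choice allI)
  then obtain r where r_orth: "\<And>n J j. j < J \<Longrightarrow> cinner (r n J) (v j) = 0"
    and r: "\<And>n J. norm (r n J - U (r n J) - q n) < inverse (real (Suc J))"
    by blast
  define R where "R j = (\<Sum>n\<le>j. \<Sum>i\<le>j. (norm (r n i))\<^sup>2)" for j
  have R0: "R j \<ge> 0" for j by (simp add: R_def sum_nonneg)
  define t where "t j = (1/2) ^ Suc j / ((1 + (norm (v j))\<^sup>2) * (1 + R j))" for j
  have t_pos: "t j > 0" for j
    unfolding t_def using R0[of j] by (intro divide_pos_pos mult_pos_pos) (auto intro: add_pos_nonneg)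
  have t_mult: "t j * (norm (v j))\<^sup>2 * s \<le> (1/2) ^ Suc j" if s: "0 \<le> s" "s \<le> 1 + R j" for j s
  proof -
    have "(norm (v j))\<^sup>2 * s \<le> (1 + (norm (v j))\<^sup>2) * (1 + R j)"
      using s by (intro mult_mono) auto
    then have "t j * ((norm (v j))\<^sup>2 * s) \<le> t j * ((1 + (norm (v j))\<^sup>2) * (1 + R j))"
      using t_pos[of j] by (intro mult_left_mono) auto
    also have "\<dots> = (1/2) ^ Suc j"
    proof -
      have "(1 + (norm (v j))\<^sup>2) * (1 + R j) > 0"
        using R0[of j] by (intro mult_pos_pos) (auto intro: add_pos_nonneg)
      moreover have "a / b * b = a" if "b > 0" for a b :: real using that by simp
      ultimately show ?thesis unfolding t_def by blast
    qed
    finally show ?thesis by (simp add: mult.assoc)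
  qed
  have t: "0 \<le> t j" "t j * (norm (v j))\<^sup>2 \<le> (1/2) ^ Suc j" for j
    using t_pos[of j] t_mult[of 1 j] R0[of j] by auto
  define \<beta> where "\<beta> x = (\<Sum>j. t j * (cmod (cinner x (v j)))\<^sup>2)" for x
  note summable_\<beta> = summable_small_quadratic_form(1)[where t = t and v = v, OF t]
  obtain B where B: "\<And>x y. B (x + y) = B x + B y" "\<And>c x. B (c *\<^sub>C x) = c *\<^sub>C B x"
    and B_le: "\<And>x. (norm (B x))\<^sup>2 \<le> \<beta> x"
    and B_diff: "\<And>x. (norm (x - B x))\<^sup>2 = (norm x)\<^sup>2 - 2 * \<beta> x + (norm (B x))\<^sup>2"
    using small_positive_operator[where t = t and v = v, OF t] unfolding \<beta>_def by blast
  define W where "W x = U (x - B x)" for x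
  have U_diff: "U (x - y) = U x - U y" for x y
    using U(1)[of "x - y" y] by (simp add: algebra_simps)
  have W_norm: "(norm x)\<^sup>2 - (norm (W x))\<^sup>2 = 2 * \<beta> x - (norm (B x))\<^sup>2" for x
    by (simp add: W_def U(3) B_diff)
  have \<beta>0: "\<beta> x \<ge> 0" for x
    unfolding \<beta>_def by (rule suminf_nonneg[OF summable_\<beta>]) (simp add: t(1))
  have "W (x + y) = W x + W y" for x y by (simp add: W_def U_diff U(1) B)
  moreover have "W (c *\<^sub>C x) = c *\<^sub>C W x" for c x
    by (simp add: W_def U_diff U(2) B complex_vector.scale_right_diff_distrib)
  moreover have "W x = U x" if "\<forall>j. cinner x (v j) = 0" for x
  proof -
    have "\<beta> x = 0" by (simp add: \<beta>_def that)
    then have "B x = 0" using B_le[of x] by simp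
    then show ?thesis by (simp add: W_def)
  qed
  moreover have "norm (W x) \<le> norm x" for x
  proof (rule power2_le_imp_le)
    show "(norm (W x))\<^sup>2 \<le> (norm x)\<^sup>2" using W_norm[of x] B_le[of x] \<beta>0[of x] by linarith
  qed simp
  moreover have "\<forall>j. cinner x (v j) = 0" if "norm (W x) = norm x" for x
  proof
    fix j
    have "\<beta> x = 0" using W_norm[of x] B_le[of x] \<beta>0[of x] that by simp
    then have "t j * (cmod (cinner x (v j)))\<^sup>2 = 0"
      using suminf_eq_zero_iff[OF summable_\<beta>, of x] t(1) unfolding \<beta>_def by simp
    then show "cinner x (v j) = 0" using t_pos[of j] by simp
  qed
  moreover have "\<exists>x. norm (x - W x - y) < \<epsilon> \<and> (norm x)\<^sup>2 - (norm (W x))\<^sup>2 < \<epsilon>" if \<epsilon>: "\<epsilon> > 0" for y \<epsilon>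
  proof -
    have "y \<in> closure (range q)" using q by simp
    moreover have "\<epsilon> / 3 > 0" using \<epsilon> by simp
    ultimately have "\<exists>z\<in>range q. dist z y < \<epsilon> / 3" unfolding closure_approachable by blast
    then obtain n where n: "norm (q n - y) < \<epsilon> / 3" by (auto simp: dist_norm)
    have "\<forall>\<^sub>F J in sequentially. inverse (real (Suc J)) < \<epsilon> / 3"
      using LIMSEQ_inverse_real_of_nat \<epsilon> by (intro order_tendstoD) auto
    moreover have half: "(\<lambda>J. (1/2::real) ^ J) \<longlonglongrightarrow> 0" by (rule LIMSEQ_power_zero) simp
    have "\<forall>\<^sub>F J in sequentially. (1/2::real) ^ J < (\<epsilon> / 3)\<^sup>2" "\<forall>\<^sub>F J in sequentially. (1/2::real) ^ J < \<epsilon> / 2"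
      using half \<epsilon> by (auto intro!: order_tendstoD)
    moreover have "\<forall>\<^sub>F J in sequentially. J \<ge> n" by (rule eventually_ge_at_top)
    ultimately have "\<forall>\<^sub>F J in sequentially. inverse (real (Suc J)) < \<epsilon> / 3 \<and>
        (1/2::real) ^ J < (\<epsilon> / 3)\<^sup>2 \<and> (1/2::real) ^ J < \<epsilon> / 2 \<and> J \<ge> n"
      by eventually_elim auto
    then obtain J where J: "inverse (real (Suc J)) < \<epsilon> / 3" "(1/2::real) ^ J < (\<epsilon> / 3)\<^sup>2"
      "(1/2::real) ^ J < \<epsilon> / 2" "J \<ge> n"
      using eventually_happens'[OF sequentially_bot] by blast
    define x where "x = r n J"
    have \<beta>x: "\<beta> x \<le> (1/2) ^ J"
    proof -
      have "\<beta> x = (\<Sum>j. t (j + J) * (cmod (cinner x (v (j + J))))\<^sup>2)"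
        using suminf_split_initial_segment[OF summable_\<beta>, of x J] by (simp add: \<beta>_def x_def r_orth)
      also have "\<dots> \<le> (\<Sum>j. (1/2) ^ J * (1/2) ^ Suc j)"
      proof (rule suminf_le)
        fix j
        have "(norm x)\<^sup>2 \<le> (\<Sum>i\<le>j + J. (norm (r n i))\<^sup>2)"
          unfolding x_def by (intro member_le_sum) auto
        also have "\<dots> \<le> R (j + J)"
          unfolding R_def using J(4)
          by (intro member_le_sum[of n _ "\<lambda>n. \<Sum>i\<le>j + J. (norm (r n i))\<^sup>2"]) (auto intro: sum_nonneg)
        finally have x_le: "t (j + J) * (norm (v (j + J)))\<^sup>2 * (norm x)\<^sup>2 \<le> (1/2) ^ Suc (j + J)"
          by (intro t_mult) auto
        have "(cmod (cinner x (v (j + J))))\<^sup>2 \<le> (norm x)\<^sup>2 * (norm (v (j + J)))\<^sup>2"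
          using power_mono[OF norm_cinner_le[of x "v (j + J)"], of 2] by (simp add: power_mult_distrib)
        then have "t (j + J) * (cmod (cinner x (v (j + J))))\<^sup>2
            \<le> t (j + J) * ((norm x)\<^sup>2 * (norm (v (j + J)))\<^sup>2)"
          by (rule mult_left_mono[OF _ t(1)])
        also have "\<dots> \<le> (1/2) ^ Suc (j + J)" using x_le by (simp add: mult_ac)
        finally show "t (j + J) * (cmod (cinner x (v (j + J))))\<^sup>2 \<le> (1/2) ^ J * (1/2) ^ Suc j"
          by (simp add: power_add mult_ac)
      next
        show "summable (\<lambda>j. t (j + J) * (cmod (cinner x (v (j + J))))\<^sup>2)"
          by (rule summable_ignore_initial_segment[OF summable_\<beta>])
        show "summable (\<lambda>j. (1/2::real) ^ J * (1/2) ^ Suc j)"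
          by (rule summable_mult[OF sums_summable[OF power_half_series]])
      qed
      also have "\<dots> = (1/2) ^ J"
        using sums_unique[OF sums_mult[OF power_half_series, of "(1/2) ^ J"]] by simp
      finally show ?thesis .
    qed
    have "(norm (B x))\<^sup>2 < (\<epsilon> / 3)\<^sup>2" using B_le[of x] \<beta>x J(2) by linarith
    then have Bx: "norm (B x) < \<epsilon> / 3" using \<epsilon> power2_less_imp_less[of "norm (B x)" "\<epsilon> / 3"] by simp
    have "x - W x - y = (x - U x - q n) + (q n - y) + U (B x)" by (simp add: W_def U_diff)
    also have "norm \<dots> \<le> norm (x - U x - q n) + norm (q n - y) + norm (U (B x))"
      by (intro norm_triangle_mono order_refl norm_triangle_ineq)
    also have "\<dots> < \<epsilon>" using r[of n J] n Bx J(1) by (simp add: x_def[symmetric] U(3))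
    finally have "norm (x - W x - y) < \<epsilon>" .
    moreover have "(norm x)\<^sup>2 - (norm (W x))\<^sup>2 < \<epsilon>"
    proof -
      have "0 \<le> (norm (B x))\<^sup>2" by simp
      then show ?thesis using W_norm[of x] \<beta>x J(3) by linarith
    qed
    ultimately show ?thesis by blast
  qed
  ultimately show thesis by (rule that[of W])
qed

section \<open>Symmetric and dissipative operators in Cayley coordinates\<close>

lemma norm_add_i_square:
  "(norm (g + \<i> *\<^sub>C f))\<^sup>2 = (norm g)\<^sup>2 + (norm f)\<^sup>2 + 2 * Im (cinner g (f::'a::complex_inner))"
  by (simp add: norm_add_square norm_scaleC cinner_scaleC_right)

lemma norm_diff_i_square:
  "(norm (g - \<i> *\<^sub>C f))\<^sup>2 = (norm g)\<^sup>2 + (norm f)\<^sup>2 - 2 * Im (cinner g (f::'a::complex_inner))"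
  by (simp add: norm_diff_square norm_scaleC cinner_scaleC_right)

text \<open>The bijection \<open>(f, g) \<mapsto> (g + i f, g - i f)\<close> takes the graph of an operator to the graph of its
  Cayley transform.\<close>

lemma half_add_half: "(1/2) *\<^sub>C x + (1/2) *\<^sub>C x = (x::'a::complex_inner)"
  by (simp flip: scaleC_add_left add: scaleC_one)

lemma cayley_coordinates:
  fixes x y :: "'a::complex_inner"
  defines "f \<equiv> (- \<i>/2) *\<^sub>C (x - y)" and "g \<equiv> (1/2) *\<^sub>C (x + y)"
  shows "g + \<i> *\<^sub>C f = x" "g - \<i> *\<^sub>C f = y"
proof -
  have if_eq: "\<i> *\<^sub>C f = (1/2) *\<^sub>C (x - y)" by (simp add: f_def scaleC_scaleC)
  have "g + \<i> *\<^sub>C f = (1/2) *\<^sub>C x + (1/2) *\<^sub>C x"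
    unfolding if_eq g_def scaleC_add_right[symmetric] by simp
  then show "g + \<i> *\<^sub>C f = x" by (simp only: half_add_half)
  have "g - \<i> *\<^sub>C f = (1/2) *\<^sub>C y + (1/2) *\<^sub>C y"
    unfolding if_eq g_def scaleC_add_right[symmetric] complex_vector.scale_right_diff_distrib[symmetric]
    by simp
  then show "g - \<i> *\<^sub>C f = y" by (simp only: half_add_half)
qed

lemma cayley_coordinates_inverse:
  fixes f g :: "'a::complex_inner"
  shows "f = (- \<i>/2) *\<^sub>C ((g + \<i> *\<^sub>C f) - (g - \<i> *\<^sub>C f))"
    and "g = (1/2) *\<^sub>C ((g + \<i> *\<^sub>C f) + (g - \<i> *\<^sub>C f))"
proof -
  have "(g + \<i> *\<^sub>C f) - (g - \<i> *\<^sub>C f) = \<i> *\<^sub>C f + \<i> *\<^sub>C f" by simp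
  also have "\<dots> = (2 * \<i>) *\<^sub>C f" by (simp flip: scaleC_add_left)
  finally show "f = (- \<i>/2) *\<^sub>C ((g + \<i> *\<^sub>C f) - (g - \<i> *\<^sub>C f))"
    by (simp add: scaleC_scaleC scaleC_one)
  have "(g + \<i> *\<^sub>C f) + (g - \<i> *\<^sub>C f) = g + g" by simp
  then show "g = (1/2) *\<^sub>C ((g + \<i> *\<^sub>C f) + (g - \<i> *\<^sub>C f))"
    by (simp add: scaleC_add_right half_add_half)
qed

lemma cayley_coordinates_inj:
  fixes f g :: "'a::complex_inner"
  assumes "g + \<i> *\<^sub>C f = g' + \<i> *\<^sub>C f'" "g - \<i> *\<^sub>C f = g' - \<i> *\<^sub>C f'"
  shows "f = f'" "g = g'"
  using cayley_coordinates_inverse[where f = f and g = g]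
    cayley_coordinates_inverse[where f = f' and g = g'] assms by metis+

lemma linear_operatorD:
  assumes "linear_operator T"
  shows "single_valued T" "(0, 0) \<in> T"
    and "(f, g) \<in> T \<Longrightarrow> (f', g') \<in> T \<Longrightarrow> (f + f', g + g') \<in> T"
    and "(f, g) \<in> T \<Longrightarrow> (c *\<^sub>C f, c *\<^sub>C g) \<in> T"
    and "(f, g) \<in> T \<Longrightarrow> (f', g') \<in> T \<Longrightarrow> (f - f', g - g') \<in> T"
    and "(f, g) \<in> T \<Longrightarrow> im_form T f = Im (cinner g f)"
    and "(0, g) \<in> T \<Longrightarrow> g = 0"
proof -
  note lin = assms[unfolded linear_operator_def]
  show 1: "single_valued T" "(0, 0) \<in> T" using lin by blast+
  show add: "(f + f', g + g') \<in> T" if "(f, g) \<in> T" "(f', g') \<in> T" for f g f' g'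
    using lin that by blast
  show scale: "(c *\<^sub>C f, c *\<^sub>C g) \<in> T" if "(f, g) \<in> T" for c f g using lin that by blast
  show "(f - f', g - g') \<in> T" if "(f, g) \<in> T" "(f', g') \<in> T"
    using add[OF that(1) scale[OF that(2), of "-1"]] by (simp add: scaleC_one)
  show "im_form T f = Im (cinner g f)" if "(f, g) \<in> T"
    using that 1 by (simp add: im_form_def op_app_eq)
  show "g = 0" if "(0, g) \<in> T" using that 1 by (meson single_valuedD)
qed

lemma symmetric_operator_Im:
  assumes "symmetric_operator S" "(f, g) \<in> S"
  shows "Im (cinner g f) = 0"
  using assms linear_operatorD(6)[of S f g] unfolding symmetric_operator_def by (metis DomainI)

lemma ran_shift_eq:
  assumes "single_valued S"
  shows "ran_shift S \<mu> = (\<lambda>(f, g). g - \<mu> *\<^sub>C f) ` S"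
  using op_app_eq[OF assms] unfolding ran_shift_def by (force simp: image_iff)

text \<open>For symmetric \<open>S\<close> the map \<open>(f, g) \<mapsto> g + i f\<close> is isometric on the graph, so it preserves
  completeness.\<close>

lemma closed_ran_shift_symmetric:
  fixes S :: "'a::complex_hilbert_space operator"
  assumes S: "symmetric_operator S" "closed S"
  shows "closed ((\<lambda>(f, g). g + \<i> *\<^sub>C f) ` S)"
proof -
  have lin: "linear_operator S" using S(1) by (simp add: symmetric_operator_def)
  have "complete ((\<lambda>(f, g). g + \<i> *\<^sub>C f) ` S)"
  proof (rule complete_isometric_image[of 1])
    show "subspace S"
      unfolding subspace_def using linear_operatorD[OF lin]
      by (auto simp: zero_prod_def scaleR_prod_def simp flip: scaleC_of_real)
    show "bounded_linear (\<lambda>(f, g). g + \<i> *\<^sub>C f :: 'a)"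
      unfolding case_prod_beta
      by (intro bounded_linear_add bounded_linear_snd
          bounded_linear_compose[OF bounded_linear_scaleC_right bounded_linear_fst])
    show "\<forall>x\<in>S. norm (case x of (f, g) \<Rightarrow> g + \<i> *\<^sub>C f) \<ge> 1 * norm x"
    proof
      fix x assume "x \<in> S"
      then have "(norm (snd x + \<i> *\<^sub>C fst x))\<^sup>2 = (norm x)\<^sup>2"
        using symmetric_operator_Im[OF S(1), of "fst x" "snd x"]
        by (simp add: norm_add_i_square norm_prod_def)
      then show "norm (case x of (f, g) \<Rightarrow> g + \<i> *\<^sub>C f) \<ge> 1 * norm x"
        by (simp add: case_prod_beta)
    qed
    show "complete S" using S(2) by (simp add: complete_eq_closed)
  qed simp
  then show ?thesis by (simp add: complete_eq_closed)
qed

lemma cayley_transform_symmetric: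
  fixes S :: "'a::complex_hilbert_space operator"
  assumes S: "symmetric_operator S" "closed S" "has_deficiency_indices S \<infinity> \<infinity>"
  shows "\<exists>V. fixpoint_free_partial_isometry ((\<lambda>(f, g). g + \<i> *\<^sub>C f) ` S) V \<and>
    (\<forall>(f, g)\<in>S. V (g + \<i> *\<^sub>C f) = g - \<i> *\<^sub>C f)"
proof -
  let ?M = "(\<lambda>(f, g). g + \<i> *\<^sub>C f) ` S"
  have lin: "linear_operator S" using S(1) by (simp add: symmetric_operator_def)
  note linD = linear_operatorD[OF lin]
  define V where "V x = (THE y. \<exists>(f, g)\<in>S. x = g + \<i> *\<^sub>C f \<and> y = g - \<i> *\<^sub>C f)" for x
  have norms: "norm (g + \<i> *\<^sub>C f) = norm (g - \<i> *\<^sub>C f)" if "(f, g) \<in> S" for f g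
  proof -
    have "(norm (g + \<i> *\<^sub>C f))\<^sup>2 = (norm (g - \<i> *\<^sub>C f))\<^sup>2"
      by (simp add: norm_add_i_square norm_diff_i_square symmetric_operator_Im[OF S(1) that])
    then show ?thesis by simp
  qed
  have V: "V (g + \<i> *\<^sub>C f) = g - \<i> *\<^sub>C f" if fg: "(f, g) \<in> S" for f g
    unfolding V_def
  proof (rule the_equality)
    show "\<exists>(f', g')\<in>S. g + \<i> *\<^sub>C f = g' + \<i> *\<^sub>C f' \<and> g - \<i> *\<^sub>C f = g' - \<i> *\<^sub>C f'"
      using fg by blast
    fix y assume "\<exists>(f', g')\<in>S. g + \<i> *\<^sub>C f = g' + \<i> *\<^sub>C f' \<and> y = g' - \<i> *\<^sub>C f'"
    then obtain f' g' where fg': "(f', g') \<in> S" "g + \<i> *\<^sub>C f = g' + \<i> *\<^sub>C f'" "y = g' - \<i> *\<^sub>C f'"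
      by blast
    have "norm ((g' - g) - \<i> *\<^sub>C (f' - f)) = norm ((g' - g) + \<i> *\<^sub>C (f' - f))"
      using norms[OF linD(5)[OF fg'(1) fg]] by simp
    also have "(g' - g) + \<i> *\<^sub>C (f' - f) = (g' + \<i> *\<^sub>C f') - (g + \<i> *\<^sub>C f)"
      by (simp add: complex_vector.scale_right_diff_distrib)
    also have "\<dots> = 0" using fg'(2) by simp
    finally have "(g' - g) - \<i> *\<^sub>C (f' - f) = 0" by simp
    moreover have "(g' - g) - \<i> *\<^sub>C (f' - f) = y - (g - \<i> *\<^sub>C f)"
      using fg'(3) by (simp add: complex_vector.scale_right_diff_distrib)
    ultimately show "y = g - \<i> *\<^sub>C f" by simp
  qed
  have M_I: "g + \<i> *\<^sub>C f \<in> ?M" if "(f, g) \<in> S" for f g using that by force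
  have add: "(g + \<i> *\<^sub>C f) + (g' + \<i> *\<^sub>C f') = (g + g') + \<i> *\<^sub>C (f + f')" for f g f' g' :: 'a
    by (simp add: scaleC_add_right)
  have scale: "c *\<^sub>C (g + \<i> *\<^sub>C f) = c *\<^sub>C g + \<i> *\<^sub>C (c *\<^sub>C f)" for c and f g :: 'a
    by (simp add: scaleC_add_right scaleC_scaleC mult.commute)
  have M': "V ` ?M = ran_shift S \<i>"
    unfolding ran_shift_eq[OF linD(1)] image_image by (rule image_cong) (auto simp: V)
  have M: "?M = ran_shift S (- \<i>)"
    unfolding ran_shift_eq[OF linD(1)] by simp
  have "fixpoint_free_partial_isometry ?M V"
  proof
    show "csubspace ?M"
    proof (rule complex_vector.subspaceI)
      show "0 \<in> ?M" using M_I[OF linD(2)] by simp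
      show "x + y \<in> ?M" if "x \<in> ?M" "y \<in> ?M" for x y
        using that M_I[OF linD(3)] by (auto simp: add)
      show "c *\<^sub>C x \<in> ?M" if "x \<in> ?M" for c x
        using that M_I[OF linD(4)] by (auto simp: scale)
    qed
    show "closed ?M" by (rule closed_ran_shift_symmetric[OF S(1,2)])
    show "V (x + y) = V x + V y" if "x \<in> ?M" "y \<in> ?M" for x y
    proof -
      obtain f g f' g' where fg: "(f, g) \<in> S" "(f', g') \<in> S" "x = g + \<i> *\<^sub>C f" "y = g' + \<i> *\<^sub>C f'"
        using \<open>x \<in> ?M\<close> \<open>y \<in> ?M\<close> by auto
      then show ?thesis
        using V[OF linD(3)[OF fg(1,2)]] by (simp only: add V) (simp add: scaleC_add_right)
    qed
    show "V (c *\<^sub>C x) = c *\<^sub>C V x" if "x \<in> ?M" for c x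
    proof -
      obtain f g where fg: "(f, g) \<in> S" "x = g + \<i> *\<^sub>C f" using \<open>x \<in> ?M\<close> by auto
      then show ?thesis
        using V[OF linD(4)[OF fg(1)], of c] 
        by (simp only: scale V)
          (simp add: complex_vector.scale_right_diff_distrib scaleC_scaleC mult.commute)
    qed
    show "norm (V x) = norm x" if "x \<in> ?M" for x using that by (auto simp: V norms)
    show "x = 0" if x: "x \<in> ?M" "V x = x" for x
    proof -
      obtain f g where fg: "(f, g) \<in> S" "x = g + \<i> *\<^sub>C f" using x by auto
      then have eq: "g - \<i> *\<^sub>C f = g + \<i> *\<^sub>C f" using x(2) V by simp
      have "f = (- \<i>/2) *\<^sub>C ((g + \<i> *\<^sub>C f) - (g - \<i> *\<^sub>C f))" by (rule cayley_coordinates_inverse)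
      then have "f = 0" by (simp only: eq) simp
      then show ?thesis using fg linD(7) by simp
    qed
    have "cdim (deficiency_subspace S \<i>) = \<infinity>" "cdim (deficiency_subspace S (- \<i>)) = \<infinity>"
      using S(3) by (simp_all add: has_deficiency_indices_def)
    then show "cdim (corthogonal_comp ?M) = \<infinity>" "cdim (corthogonal_comp (V ` ?M)) = \<infinity>"
      unfolding M' by (simp_all add: M deficiency_subspace_def)
  qed
  then show ?thesis using V by blast
qed

text \<open>The operator with Cayley transform \<open>W\<close>, in implicit form: this makes inclusions between graphs
  immediate, while the explicit parametrization by \<open>x = g + i f\<close> follows.\<close>

definition inverse_cayley :: "('a::complex_inner \<Rightarrow> 'a) \<Rightarrow> 'a operator" where
  "inverse_cayley W = {(f, g). W (g + \<i> *\<^sub>C f) = g - \<i> *\<^sub>C f}"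

locale fixpoint_free_contraction =
  fixes W :: "'a::complex_inner \<Rightarrow> 'a"
  assumes W_add: "\<And>x y. W (x + y) = W x + W y" and W_scaleC: "\<And>c x. W (c *\<^sub>C x) = c *\<^sub>C W x"
    and W_contraction: "\<And>x. norm (W x) \<le> norm x" and W_fixpoint: "\<And>x. W x = x \<Longrightarrow> x = 0"
begin

lemma inverse_cayley_cover:
  "((- \<i>/2) *\<^sub>C (x - W x), (1/2) *\<^sub>C (x + W x)) \<in> inverse_cayley W"
  unfolding inverse_cayley_def mem_Collect_eq prod.case cayley_coordinates by (rule refl)

lemma linear_operator_inverse_cayley: "linear_operator (inverse_cayley W)"
proof -
  have add: "(f + f', g + g') \<in> inverse_cayley W"
    if fg: "(f, g) \<in> inverse_cayley W" "(f', g') \<in> inverse_cayley W" for f g f' g'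
  proof -
    have eq: "(g + g') + \<i> *\<^sub>C (f + f') = (g + \<i> *\<^sub>C f) + (g' + \<i> *\<^sub>C f')"
      by (simp add: scaleC_add_right)
    have "W ((g + g') + \<i> *\<^sub>C (f + f')) = W (g + \<i> *\<^sub>C f) + W (g' + \<i> *\<^sub>C f')"
      unfolding eq by (rule W_add)
    also have "\<dots> = (g - \<i> *\<^sub>C f) + (g' - \<i> *\<^sub>C f')"
      using fg by (simp add: inverse_cayley_def)
    finally have "W ((g + g') + \<i> *\<^sub>C (f + f')) = (g - \<i> *\<^sub>C f) + (g' - \<i> *\<^sub>C f')" .
    then show ?thesis by (simp add: inverse_cayley_def scaleC_add_right)
  qed
  have scale: "(c *\<^sub>C f, c *\<^sub>C g) \<in> inverse_cayley W" if fg: "(f, g) \<in> inverse_cayley W" for c f g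
  proof -
    have eq: "c *\<^sub>C g + \<i> *\<^sub>C (c *\<^sub>C f) = c *\<^sub>C (g + \<i> *\<^sub>C f)"
      by (simp add: scaleC_add_right scaleC_scaleC mult.commute)
    have "W (c *\<^sub>C g + \<i> *\<^sub>C (c *\<^sub>C f)) = c *\<^sub>C (g - \<i> *\<^sub>C f)"
      unfolding eq W_scaleC using fg by (simp add: inverse_cayley_def)
    then show ?thesis
      by (simp add: inverse_cayley_def complex_vector.scale_right_diff_distrib scaleC_scaleC mult.commute)
  qed
  have zero: "(0, 0) \<in> inverse_cayley W" using W_scaleC[of 0 0] by (simp add: inverse_cayley_def)
  have "single_valued (inverse_cayley W)"
  proof (rule single_valuedI)
    fix f g g' assume "(f, g) \<in> inverse_cayley W" "(f, g') \<in> inverse_cayley W"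
    then have "(0, g - g') \<in> inverse_cayley W" using add[OF _ scale[of f g' "-1"], of f g] by (simp add: scaleC_one)
    then show "g = g'" using W_fixpoint[of "g - g'"] by (simp add: inverse_cayley_def)
  qed
  then show ?thesis unfolding linear_operator_def using add scale zero by blast
qed

lemma im_form_inverse_cayley:
  assumes fg: "(f, g) \<in> inverse_cayley W"
  shows "4 * im_form (inverse_cayley W) f = (norm (g + \<i> *\<^sub>C f))\<^sup>2 - (norm (W (g + \<i> *\<^sub>C f)))\<^sup>2"
proof -
  have "W (g + \<i> *\<^sub>C f) = g - \<i> *\<^sub>C f" using fg by (simp add: inverse_cayley_def)
  then show ?thesis
    by (simp add: norm_add_i_square norm_diff_i_square
        linear_operatorD(6)[OF linear_operator_inverse_cayley fg])
qed

text \<open>Maximality holds because \<open>T + i\<close> is surjective for \<open>T = inverse_cayley W\<close>: an element of a dissipative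
  extension differs from one of \<open>T\<close> by some \<open>(f, - i f)\<close>, for which the imaginary part is \<open>- \<parallel>f\<parallel>\<^sup>2\<close>.\<close>

lemma maximal_dissipative_inverse_cayley: "maximal_dissipative (inverse_cayley W)"
  unfolding maximal_dissipative_def
proof (intro conjI allI impI)
  have "im_form (inverse_cayley W) f \<ge> 0" if "(f, g) \<in> inverse_cayley W" for f g
    using im_form_inverse_cayley[OF that] power_mono[OF W_contraction[of "g + \<i> *\<^sub>C f"] norm_ge_zero, of 2] by linarith
  then show "dissipative (inverse_cayley W)"
    using linear_operator_inverse_cayley by (auto simp: dissipative_def)
next
  fix T' assume T': "dissipative T'" "inverse_cayley W \<subseteq> T'"
  have lin: "linear_operator T'" using T' by (simp add: dissipative_def)
  have "(f, g) \<in> inverse_cayley W" if fg: "(f, g) \<in> T'" for f g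
  proof -
    let ?x = "g + \<i> *\<^sub>C f"
    define f0 g0 where "f0 = (- \<i>/2) *\<^sub>C (?x - W ?x)" and "g0 = (1/2) *\<^sub>C (?x + W ?x)"
    have T0: "(f0, g0) \<in> inverse_cayley W" unfolding f0_def g0_def by (rule inverse_cayley_cover)
    have "g0 + \<i> *\<^sub>C f0 = ?x" unfolding f0_def g0_def by (rule cayley_coordinates)
    moreover have "(g - g0) + \<i> *\<^sub>C (f - f0) = ?x - (g0 + \<i> *\<^sub>C f0)"
      by (simp add: complex_vector.scale_right_diff_distrib)
    ultimately have "(g - g0) + \<i> *\<^sub>C (f - f0) = 0" by simp
    then have g: "g - g0 = - (\<i> *\<^sub>C (f - f0))" by (simp add: eq_neg_iff_add_eq_0)
    have d: "(f - f0, g - g0) \<in> T'" using linear_operatorD(5)[OF lin fg] T0 T'(2) by blast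
    then have "im_form T' (f - f0) \<ge> 0" using T'(1) unfolding dissipative_def by blast
    then have "Im (cinner (g - g0) (f - f0)) \<ge> 0" by (simp only: linear_operatorD(6)[OF lin d])
    then have "f - f0 = 0"
      unfolding g cinner_minus_left cinner_scaleC_left cinner_self by simp
    then show ?thesis using g T0 by simp
  qed
  then show "T' = inverse_cayley W" using T'(2) by auto
qed

lemma singular_im_form_inverse_cayley:
  assumes approx: "\<And>y \<epsilon>. \<epsilon> > 0 \<Longrightarrow> \<exists>x. norm (x - W x - y) < \<epsilon> \<and> (norm x)\<^sup>2 - (norm (W x))\<^sup>2 < \<epsilon>"
  shows "singular_im_form (inverse_cayley W)"
  unfolding singular_im_form_def
proof
  fix f :: 'a
  have "\<exists>x. norm (x - W x - (2 * \<i>) *\<^sub>C f) < inverse (real (Suc n)) \<and>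
      (norm x)\<^sup>2 - (norm (W x))\<^sup>2 < inverse (real (Suc n))" for n
    by (rule approx) simp
  then obtain x where x: "\<And>n. norm (x n - W (x n) - (2 * \<i>) *\<^sub>C f) < inverse (real (Suc n))"
    "\<And>n. (norm (x n))\<^sup>2 - (norm (W (x n)))\<^sup>2 < inverse (real (Suc n))" by metis
  define u where "u n = (- \<i>/2) *\<^sub>C (x n - W (x n))" for n
  have u: "(u n, (1/2) *\<^sub>C (x n + W (x n))) \<in> inverse_cayley W" for n
    unfolding u_def by (rule inverse_cayley_cover)
  have "norm (u n - f) \<le> inverse (real (Suc n))" for n
  proof -
    have "u n - f = (- \<i>/2) *\<^sub>C (x n - W (x n) - (2 * \<i>) *\<^sub>C f)"
      by (simp add: u_def complex_vector.scale_right_diff_distrib scaleC_scaleC scaleC_one)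
    then have "norm (u n - f) = norm (x n - W (x n) - (2 * \<i>) *\<^sub>C f) / 2"
      by (simp only: norm_scaleC) (simp add: norm_divide)
    then show ?thesis using x(1)[of n] norm_ge_zero[of "x n - W (x n) - (2 * \<i>) *\<^sub>C f"] by linarith
  qed
  then have "(\<lambda>n. u n - f) \<longlonglongrightarrow> 0"
    by (intro Lim_null_comparison[OF _ LIMSEQ_inverse_real_of_nat] always_eventually) simp
  then have "u \<longlonglongrightarrow> f" by (simp add: Lim_null[symmetric])
  moreover have "norm (im_form (inverse_cayley W) (u n)) \<le> inverse (real (Suc n))" for n
  proof -
    have "(1/2) *\<^sub>C (x n + W (x n)) + \<i> *\<^sub>C u n = x n"
      unfolding u_def by (rule cayley_coordinates)
    then have "4 * im_form (inverse_cayley W) (u n) = (norm (x n))\<^sup>2 - (norm (W (x n)))\<^sup>2"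
      using im_form_inverse_cayley[OF u[of n]] by simp
    then show ?thesis
      using x(2)[of n] power_mono[OF W_contraction[of "x n"] norm_ge_zero, of 2]
      unfolding real_norm_def by linarith
  qed
  then have "(\<lambda>n. im_form (inverse_cayley W) (u n)) \<longlonglongrightarrow> 0"
    by (intro Lim_null_comparison[OF _ LIMSEQ_inverse_real_of_nat] always_eventually) simp
  ultimately show "\<exists>u. (\<forall>n. u n \<in> Domain (inverse_cayley W)) \<and> u \<longlonglongrightarrow> f \<and>
      (\<lambda>n. im_form (inverse_cayley W) (u n)) \<longlonglongrightarrow> 0"
    using u by blast
qed

end

theorem theorem7p1:
  fixes S :: "'a::complex_hilbert_space operator"
  assumes "separable_space (euclidean :: 'a topology)"
    and "cdim (UNIV :: 'a set) = \<infinity>"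
    and "symmetric_operator S"
    and "closed S"
    and "\<not> densely_defined S"
    and "has_deficiency_indices S \<infinity> \<infinity>"
  shows "\<exists>T. S \<subseteq> T \<and> maximal_dissipative T \<and> T \<in> D_sing \<and> hermitian_part T = S"
proof -
  have lin: "linear_operator S" using assms(3) by (simp add: symmetric_operator_def)
  obtain Q :: "'a set" where Q: "countable Q" "closure Q = UNIV"
    using assms(1) unfolding separable_space_def by (auto simp: euclidean_closure_of)
  then have "Q \<noteq> {}" by auto
  define q where "q = from_nat_into Q"
  have q: "closure (range q) = UNIV" using Q \<open>Q \<noteq> {}\<close> by (simp add: q_def range_from_nat_into)
  let ?M = "(\<lambda>(f, g). g + \<i> *\<^sub>C f) ` S"
  obtain V where "fixpoint_free_partial_isometry ?M V"
    and V: "\<And>f g. (f, g) \<in> S \<Longrightarrow> V (g + \<i> *\<^sub>C f) = g - \<i> *\<^sub>C f"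
    using cayley_transform_symmetric[OF assms(3,4,6)] by blast
  then interpret fixpoint_free_partial_isometry ?M V by simp
  obtain U and v :: "nat \<Rightarrow> 'a" where U: "\<And>x y. U (x + y) = U x + U y" "\<And>c x. U (c *\<^sub>C x) = c *\<^sub>C U x"
    "\<And>x. norm (U x) = norm x" and UV: "\<And>x. x \<in> ?M \<Longrightarrow> U x = V x"
    and v: "\<And>x. (\<forall>j. cinner x (v j) = 0) \<longleftrightarrow> x \<in> ?M"
    and dense: "\<And>J. closure ((\<lambda>x. x - U x) ` {x. \<forall>j<J. cinner x (v j) = 0}) = UNIV"
    by (rule isometric_extension_with_dense_differences[OF q]) (rule that; assumption)
  obtain W where W: "\<And>x y. W (x + y) = W x + W y" "\<And>c x. W (c *\<^sub>C x) = c *\<^sub>C W x"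
    "\<And>x. norm (W x) \<le> norm x"
    and WU: "\<And>x. \<forall>j. cinner x (v j) = 0 \<Longrightarrow> W x = U x"
    and strict: "\<And>x. norm (W x) = norm x \<Longrightarrow> \<forall>j. cinner x (v j) = 0"
    and approx: "\<And>y \<epsilon>. \<epsilon> > 0 \<Longrightarrow> \<exists>x. norm (x - W x - y) < \<epsilon> \<and> (norm x)\<^sup>2 - (norm (W x))\<^sup>2 < \<epsilon>"
    by (rule contraction_with_singular_defect[OF U dense q]) (rule that; assumption)
  have WV: "W x = V x" if "x \<in> ?M" for x using WU[of x] UV[OF that] v[of x] that by simp
  note strict = strict[unfolded v]
  have fixpoint: "x = 0" if "W x = x" for x
    using that strict[of x] WV[of x] V_fixpoint[of x] by simp
  interpret W: fixpoint_free_contraction W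
    by unfold_locales (fact W fixpoint)+
  have singular: "singular_im_form (inverse_cayley W)"
    by (rule W.singular_im_form_inverse_cayley) (rule approx)
  have ST: "S \<subseteq> inverse_cayley W"
  proof (rule subrelI)
    fix f g assume fg: "(f, g) \<in> S"
    then have "g + \<i> *\<^sub>C f \<in> ?M" by force
    then show "(f, g) \<in> inverse_cayley W" using WV V[OF fg] by (simp add: inverse_cayley_def)
  qed
  have "hermitian_part (inverse_cayley W) = S"
  proof
    show "S \<subseteq> hermitian_part (inverse_cayley W)"
    proof (rule subrelI)
      fix f g assume fg: "(f, g) \<in> S"
      then have "im_form (inverse_cayley W) f = 0"
        using ST linear_operatorD(6)[OF W.linear_operator_inverse_cayley] symmetric_operator_Im[OF assms(3) fg] by auto
      then show "(f, g) \<in> hermitian_part (inverse_cayley W)"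
        using fg ST by (auto simp: hermitian_part_def hermitian_domain_def)
    qed
    show "hermitian_part (inverse_cayley W) \<subseteq> S"
    proof (rule subrelI)
      fix f g assume "(f, g) \<in> hermitian_part (inverse_cayley W)"
      then have fg: "(f, g) \<in> inverse_cayley W" and "im_form (inverse_cayley W) f = 0"
        by (auto simp: hermitian_part_def hermitian_domain_def)
      then have "norm (W (g + \<i> *\<^sub>C f)) = norm (g + \<i> *\<^sub>C f)" using W.im_form_inverse_cayley[OF fg] by simp
      then have "g + \<i> *\<^sub>C f \<in> ?M" by (rule strict)
      then obtain f' g' where fg': "(f', g') \<in> S" "g + \<i> *\<^sub>C f = g' + \<i> *\<^sub>C f'" by auto
      moreover have "g - \<i> *\<^sub>C f = g' - \<i> *\<^sub>C f'"
        using fg ST fg' by (auto simp: inverse_cayley_def)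
      ultimately show "(f, g) \<in> S" using cayley_coordinates_inj by metis
    qed
  qed
  then show ?thesis using ST W.maximal_dissipative_inverse_cayley singular by (auto simp: D_sing_def)
qed

end
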